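(* Let $G$ be a compact commutative topological group, and let $g\in G$ be such that $\chi(g)\ne1$ for all characters $\chi$ of $G$ different from the unity character $\mathbf{1}$. Let $\gamma$ be a scalar-valued function on $G$. Then the equation $$\varphi(gx)-\varphi(x)=\gamma(x),\quad x\in G,$$ has a solution $\varphi\in C(G)$ if and only if $\gamma\in C(G)$ and the sums $$s_n(x)=\sum_{k=0}^n\gamma(g^kx),\quad n\ge0,$$ are uniformly bounded (in $n\ge 0$ and $x\in G$). Under these conditions and with real-valued $\gamma$, the continuous solution is $$\varphi(x)=\sup_{n\ge0}[-s_n(x)]$$ up to an arbitrary additive constant.
   Context: A character of a commutative topological group $G$ is a continuous function $\chi:G\to\mathbb{T}=\{z\in\mathbb{C}:|z|=1\}$ such that $\chi(gh)=\chi(g)\chi(h)$ for all $g,h\in G$; the unity character is $\mathbf{1}(x)\equiv1$. Scalars are real or complex, and $C(G)$ is the space of continuous scalar-valued functions on $G$. *)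

theory Defs
  imports Complex_Main
begin

text \<open>
  The ambient group is a type of class \<^class>\<open>topological_ab_group_add\<close>, hence written additively:
  \<open>g x\<close> becomes \<open>g + x\<close> and \<open>g\<^sup>k\<close> becomes the \<open>k\<close>-fold sum \<open>nat_multiple k g\<close>. The class does not
  include the Hausdorff axiom.
\<close>

definition topological_character :: "('a::topological_ab_group_add \<Rightarrow> complex) \<Rightarrow> bool" where
  "topological_character \<chi> \<longleftrightarrow>
     continuous_on UNIV \<chi> \<and> (\<forall>x. norm (\<chi> x) = 1) \<and> (\<forall>x y. \<chi> (x + y) = \<chi> x * \<chi> y)"

primrec nat_multiple :: "nat \<Rightarrow> 'a::ab_group_add \<Rightarrow> 'a" where
  "nat_multiple 0 g = 0"
| "nat_multiple (Suc k) g = g + nat_multiple k g"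

definition orbit_sum :: "'a::ab_group_add \<Rightarrow> ('a \<Rightarrow> 'b::comm_monoid_add) \<Rightarrow> nat \<Rightarrow> 'a \<Rightarrow> 'b" where
  "orbit_sum g \<gamma> n x = (\<Sum>k=0..n. \<gamma> (nat_multiple k g + x))"

definition orbit_sums_bounded :: "'a::ab_group_add \<Rightarrow> ('a \<Rightarrow> 'b::real_normed_vector) \<Rightarrow> bool" where
  "orbit_sums_bounded g \<gamma> \<longleftrightarrow> (\<exists>M. \<forall>n x. norm (orbit_sum g \<gamma> n x) \<le> M)"

definition continuous_solution ::
  "'a::topological_ab_group_add \<Rightarrow> ('a \<Rightarrow> 'b::real_normed_vector) \<Rightarrow> ('a \<Rightarrow> 'b) \<Rightarrow> bool" where
  "continuous_solution g \<gamma> \<phi> \<longleftrightarrow> continuous_on UNIV \<phi> \<and> (\<forall>x. \<phi> (g + x) - \<phi> x = \<gamma> x)"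

end

theory Submission
  imports Defs "HOL-Analysis.Uniform_Limit"
begin

text \<open>
  Write \<open>B\<^sub>n(x) = \<gamma>(x) + \<dots> + \<gamma>(g\<^sup>n\<^sup>-\<^sup>1x)\<close>. A continuous solution \<open>\<phi>\<close> turns these sums into
  \<open>\<phi>(g\<^sup>nx) - \<phi>(x)\<close>, so they are bounded. The converse is the Gottschalk--Hedlund argument, and it
  needs that the rotation \<open>x \<mapsto> gx\<close> has no continuous invariant functions except the constants. This is
  where the hypothesis on characters enters, and it is the deep half of the proof: a nonconstant
  invariant function must produce a nontrivial character \<open>\<chi>\<close> with \<open>\<chi>(g) = 1\<close>. The Haar
  integral and the spectral projections that this takes are obtained by averaging and by a power method.

  \<^bold>\<open>Mean.\<close> Averaging a continuous function over finitely many translates, chosen by compactness and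
  iterated, makes it nearly constant (\<open>uniform_averages_nearly_constant\<close>). The limiting constant is the
  invariant mean. Since one list of translates serves a whole equicontinuous family, the mean satisfies a
  Fubini law (\<open>mean_swap\<close>), and convolution becomes a commutative, associative product on the continuous
  functions.

  \<^bold>\<open>Characters.\<close> For a self-adjoint \<open>k \<noteq> 0\<close>, the suitably normalized even convolution powers of \<open>k\<close>
  converge uniformly to a continuous idempotent \<open>p\<close>, which is an eigenvector of convolution with \<open>k * k\<close>
  (\<open>top_projection\<close>). A nonzero self-adjoint idempotent has squared norm at least \<open>1\<close>. If some
  translate of \<open>p\<close> is not a multiple of \<open>p\<close>, then the same construction splits off a smaller idempotent
  and lowers the squared norm by at least \<open>1\<close>; hence after finitely many steps an idempotent is
  reached whose translates are all multiples of it, and this is a character up to scaling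
  (\<open>projection_dominates_character\<close>). If \<open>f \<noteq> 0\<close> is invariant with mean \<open>0\<close> and \<open>k = f * f\<^sup>*\<close>, the character
  so found is an eigenvector of convolution with \<open>k * k\<close> for a nonzero eigenvalue, so it is
  invariant under \<open>g\<close> and nontrivial (\<open>invariant_continuous_is_constant\<close>).

  \<^bold>\<open>Dynamics.\<close> The function \<open>m(x) = sup\<^sub>n f(g\<^sup>nx)\<close> is continuous and cannot increase along orbits; as it has
  the same mean as its translate, it is invariant and therefore constant. So every forward orbit nearly
  attains the supremum of every continuous \<open>f\<close> (\<open>forward_orbit_approaches_values\<close>). Applied to a sum \<open>B\<^sub>n\<close>
  that is almost as large as possible, this shows that \<open>\<Phi> = sup\<^sub>n B\<^sub>n\<close> is continuous. One has
  \<open>\<Phi>(x) \<ge> \<gamma>(x) + \<Phi>(gx)\<close>, and comparing means forces equality, so \<open>-\<Phi>\<close> solves the equation. Applied to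
  the negative of a solution, it yields the formula with the supremum.
\<close>

text \<open>
  The symbol \<open>\<chi>\<close> is kept free for characters.
\<close>

unbundle no vec_syntax

section \<open>Averages over finitely many translates\<close>

definition avg :: "'a::ab_group_add list \<Rightarrow> ('a \<Rightarrow> 'b::real_vector) \<Rightarrow> 'a \<Rightarrow> 'b" where
  "avg A f x = (\<Sum>a\<leftarrow>A. f (a + x)) /\<^sub>R real (length A)"

lemma avg_const: "A \<noteq> [] \<Longrightarrow> avg A (\<lambda>_. c) x = c"
proof -
  assume "A \<noteq> []"
  moreover have "(\<Sum>a\<leftarrow>A. c) = real (length A) *\<^sub>R c"
    by (induction A) (auto simp: scaleR_left.add)
  ultimately show ?thesis by (simp add: avg_def)
qed

lemma avg_add: "avg A (\<lambda>x. f x + h x) y = avg A f y + avg A h y"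
  by (simp add: avg_def sum_list_addf scaleR_add_right)

lemma avg_uminus: "avg A (\<lambda>x. - f x) y = - avg A f y"
proof -
  have "(\<Sum>a\<leftarrow>A. - f (a + y)) = - (\<Sum>a\<leftarrow>A. f (a + y))" by (induction A) auto
  then show ?thesis by (simp add: avg_def)
qed

lemma avg_diff: "avg A (\<lambda>x. f x - h x) y = avg A f y - avg A h y"
  using avg_add[of A f "\<lambda>x. - h x" y] by (simp add: avg_uminus)

lemma avg_linear:
  assumes "linear L"
  shows "avg A (\<lambda>x. L (f x)) y = L (avg A f y)"
proof -
  interpret linear L by fact
  have "(\<Sum>a\<leftarrow>A. L (f (a + y))) = L (\<Sum>a\<leftarrow>A. f (a + y))"
    by (induction A) (auto simp: zero add)
  then show ?thesis by (simp add: avg_def scale)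
qed

lemma avg_compose: "avg A (avg B f) x = avg (concat (map (\<lambda>a. map ((+) a) B) A)) f x"
proof -
  have l: "length (concat (map (\<lambda>a. map ((+) a) B) A)) = length A * length B"
    by (induction A) auto
  have "(\<Sum>c\<leftarrow>concat (map (\<lambda>a. map ((+) a) B) A). f (c + x)) = (\<Sum>a\<leftarrow>A. \<Sum>b\<leftarrow>B. f (b + (a + x)))"
    by (induction A) (auto simp: o_def add_ac)
  moreover have "(\<Sum>a\<leftarrow>A. (\<Sum>b\<leftarrow>B. f (b + (a + x))) /\<^sub>R r) = (\<Sum>a\<leftarrow>A. \<Sum>b\<leftarrow>B. f (b + (a + x))) /\<^sub>R r" for r
    by (induction A) (auto simp: scaleR_add_right)
  ultimately show ?thesis
    by (simp add: avg_def l)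
qed

lemma avg_commute:
  fixes f :: "'a::ab_group_add \<Rightarrow> 'b::real_vector"
  shows "avg A (avg B f) x = avg B (avg A f) x"
proof -
  have "(\<Sum>a\<leftarrow>A. \<Sum>b\<leftarrow>B. f (b + (a + x))) = (\<Sum>b\<leftarrow>B. \<Sum>a\<leftarrow>A. f (a + (b + x)))"
  proof (induction A)
    case Nil
    then show ?case by (induction B) auto
  next
    case (Cons a A)
    then show ?case by (simp add: sum_list_addf add.left_commute)
  qed
  moreover have "(\<Sum>a\<leftarrow>A. h a /\<^sub>R r) = (\<Sum>a\<leftarrow>A. h a) /\<^sub>R r" for A :: "'a list" and r and h :: "'a \<Rightarrow> 'b"
    by (induction A) (auto simp: scaleR_add_right)
  ultimately show ?thesis
    by (simp add: avg_def mult.commute)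
qed

lemma norm_avg_le:
  fixes f :: "'a::ab_group_add \<Rightarrow> 'b::real_normed_vector"
  assumes "A \<noteq> []" "\<And>x. norm (f x) \<le> B"
  shows "norm (avg A f x) \<le> B"
proof -
  have "norm (\<Sum>a\<leftarrow>A. f (a + x)) \<le> real (length A) * B"
  proof (induction A)
    case (Cons a A)
    then show ?case using assms(2)[of "a + x"] norm_triangle_ineq[of "f (a + x)" "\<Sum>a\<leftarrow>A. f (a + x)"]
      by (simp add: algebra_simps)
  qed auto
  then show ?thesis using assms(1) by (simp add: avg_def field_simps)
qed

lemma norm_avg_diff_le:
  fixes f :: "'a::ab_group_add \<Rightarrow> 'b::real_normed_vector"
  assumes "A \<noteq> []" "\<And>x. norm (f x - c) \<le> B"
  shows "norm (avg A f x - c) \<le> B"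
  using norm_avg_le[OF assms(1), of "\<lambda>x. f x - c" B x] assms by (simp add: avg_diff avg_const)

text \<open>
  Averaging operators commute: the function averaged over both lists is close to \<open>c\<close> as well as to \<open>d\<close>.
\<close>
lemma avg_constants_close:
  fixes f :: "'a::ab_group_add \<Rightarrow> 'b::real_normed_vector"
  assumes "A \<noteq> []" "\<And>x. norm (avg A f x - c) \<le> \<epsilon>" "B \<noteq> []" "\<And>x. norm (avg B f x - d) \<le> \<delta>"
  shows "norm (c - d) \<le> \<epsilon> + \<delta>"
proof -
  have "norm (avg B (avg A f) 0 - c) \<le> \<epsilon>"
    by (rule norm_avg_diff_le) (use assms in auto)
  moreover have "norm (avg A (avg B f) 0 - d) \<le> \<delta>"
    by (rule norm_avg_diff_le) (use assms in auto)
  ultimately show ?thesis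
    unfolding avg_commute[of B A]
    using norm_triangle_ineq4[of "avg A (avg B f) 0 - d" "avg A (avg B f) 0 - c"] by simp
qed

section \<open>Equicontinuous families are averaged to constants\<close>

text \<open>
  Equicontinuity is taken uniformly over the group, a point being moved by a small translation \<open>u\<close>;
  on a compact group this is no stronger than equicontinuity at every point.
\<close>
definition equicontinuous :: "('a::topological_ab_group_add \<Rightarrow> 'b::real_normed_vector) set \<Rightarrow> bool" where
  "equicontinuous \<Phi> \<longleftrightarrow> (\<forall>\<epsilon>>0. \<exists>U. open U \<and> 0 \<in> U \<and> (\<forall>f\<in>\<Phi>. \<forall>u\<in>U. \<forall>x. norm (f (u + x) - f x) \<le> \<epsilon>))"

lemma continuous_on_UNIV_compose:
  "continuous_on UNIV f \<Longrightarrow> continuous_on S h \<Longrightarrow> continuous_on S (\<lambda>x. f (h x))"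
  by (rule continuous_on_compose2) auto

lemma continuous_on_section:
  "continuous_on UNIV (\<lambda>(x, y). F x y) \<Longrightarrow> continuous_on UNIV (F x)"
  using continuous_on_UNIV_compose[of "\<lambda>(x, y). F x y" UNIV "\<lambda>y. (x, y)"]
  by (simp add: continuous_intros)

text \<open>
  The increment vanishes at \<open>s = 0\<close> for all \<open>x\<close> and \<open>y\<close>; the tube lemma over the compact set of pairs
  \<open>(x, y)\<close> gives a neighbourhood of \<open>0\<close> on which it is uniformly small.
\<close>
lemma equicontinuous_sections:
  fixes F :: "'b::topological_space \<Rightarrow> 'a::topological_ab_group_add \<Rightarrow> 'c::real_normed_vector"
  assumes "compact (UNIV :: 'a set)" "compact (UNIV :: 'b set)"
    and F: "continuous_on UNIV (\<lambda>(x, y). F x y)"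
  shows "equicontinuous (range F)"
  unfolding equicontinuous_def
proof (intro allI impI)
  fix \<epsilon> :: real assume "\<epsilon> > 0"
  define W where "W = {(s, x, y). norm (F x (s + y) - F x y) < \<epsilon>}"
  have c: "continuous_on UNIV (\<lambda>(s, x, y). norm (F x (s + y) - F x y))"
  proof -
    have "continuous_on UNIV (\<lambda>p :: 'a \<times> 'b \<times> 'a. (fst (snd p), fst p + snd (snd p)))"
      "continuous_on UNIV (\<lambda>p :: 'a \<times> 'b \<times> 'a. (fst (snd p), snd (snd p)))"
      by (intro continuous_intros)+
    from this[THEN continuous_on_UNIV_compose[OF F]] show ?thesis
      by (simp add: case_prod_beta continuous_on_norm continuous_on_diff)
  qed
  have "open W"
    using open_Collect_less[OF c, of "\<lambda>_. \<epsilon>"] by (simp add: W_def case_prod_unfold)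
  moreover have "compact (UNIV \<times> UNIV :: ('b \<times> 'a) set)"
    using assms by (intro compact_Times)
  moreover have "{0} \<times> (UNIV \<times> UNIV) \<subseteq> W"
    using \<open>\<epsilon> > 0\<close> by (auto simp: W_def)
  ultimately obtain U where U: "0 \<in> U" "open U" "U \<times> (UNIV \<times> UNIV) \<subseteq> W"
    using tube_lemma[of "UNIV \<times> UNIV" W 0] by blast
  have "norm (F x (u + y) - F x y) \<le> \<epsilon>" if "u \<in> U" for u x y
    using subsetD[OF U(3), of "(u, x, y)"] that by (simp add: W_def)
  with U(1,2) show "\<exists>U. open U \<and> 0 \<in> U \<and> (\<forall>f\<in>range F. \<forall>u\<in>U. \<forall>x. norm (f (u + x) - f x) \<le> \<epsilon>)"
    by blast
qed

lemma equicontinuous_single: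
  fixes f :: "'a::topological_ab_group_add \<Rightarrow> 'c::real_normed_vector"
  assumes "compact (UNIV :: 'a set)" "continuous_on UNIV f"
  shows "equicontinuous {f}"
proof -
  have "continuous_on UNIV (\<lambda>(x::'a, y). f y)"
    using continuous_on_UNIV_compose[OF assms(2), of UNIV "\<lambda>p :: 'a \<times> 'a. snd p"]
    by (simp add: case_prod_beta continuous_on_snd)
  then have "equicontinuous (range (\<lambda>x::'a. f))"
    by (intro equicontinuous_sections assms) auto
  then show ?thesis by simp
qed

lemma equicontinuous_Un: "equicontinuous \<Phi> \<Longrightarrow> equicontinuous \<Psi> \<Longrightarrow> equicontinuous (\<Phi> \<union> \<Psi>)"
  unfolding equicontinuous_def
proof (intro allI impI)
  fix \<epsilon> :: real
  assume *: "\<epsilon> > 0" "\<forall>\<epsilon>>0. \<exists>U. open U \<and> 0 \<in> U \<and> (\<forall>f\<in>\<Phi>. \<forall>u\<in>U. \<forall>x. norm (f (u + x) - f x) \<le> \<epsilon>)"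
    "\<forall>\<epsilon>>0. \<exists>U. open U \<and> 0 \<in> U \<and> (\<forall>f\<in>\<Psi>. \<forall>u\<in>U. \<forall>x. norm (f (u + x) - f x) \<le> \<epsilon>)"
  then obtain U V where "open U \<and> 0 \<in> U \<and> (\<forall>f\<in>\<Phi>. \<forall>u\<in>U. \<forall>x. norm (f (u + x) - f x) \<le> \<epsilon>)"
    "open V \<and> 0 \<in> V \<and> (\<forall>f\<in>\<Psi>. \<forall>u\<in>V. \<forall>x. norm (f (u + x) - f x) \<le> \<epsilon>)" by meson
  then show "\<exists>U. open U \<and> 0 \<in> U \<and> (\<forall>f\<in>\<Phi> \<union> \<Psi>. \<forall>u\<in>U. \<forall>x. norm (f (u + x) - f x) \<le> \<epsilon>)"
    by (intro exI[of _ "U \<inter> V"]) auto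
qed

lemma equicontinuous_contraction:
  assumes "equicontinuous \<Phi>" "\<And>x y. norm (L x - L y) \<le> norm (x - y)"
  shows "equicontinuous ((\<lambda>f x. L (f x)) ` \<Phi>)"
  using assms unfolding equicontinuous_def by simp (meson order_trans)

text \<open>
  Used with \<open>z = y - x\<close>: among the translates of any point \<open>x\<close> by \<open>A\<close>, at least one is \<open>U\<close>-close to any
  prescribed point \<open>y\<close>.
\<close>
lemma compact_cover_translates:
  assumes "compact (UNIV :: 'a::topological_ab_group_add set)" "open U" "(0::'a) \<in> U"
  obtains A where "A \<noteq> []" "\<And>z. \<exists>a\<in>set A. a - z \<in> U"
proof -
  have o: "open {z. a - z \<in> U}" for a
    using open_vimage[OF assms(2), of "\<lambda>z. a - z"] by (simp add: vimage_def continuous_intros)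
  obtain C where C: "C \<subseteq> UNIV" "finite C" "UNIV \<subseteq> (\<Union>a\<in>C. {z. a - z \<in> U})"
    by (rule compactE_image[OF assms(1), of UNIV "\<lambda>a. {z. a - z \<in> U}"]) (use o assms in auto)
  obtain A where "set A = C" using C(2) finite_list by blast
  moreover have "C \<noteq> {}" using C(3) by auto
  ultimately show ?thesis using C(3) that[of A] by fastforce
qed

lemma avg_funpow_eq_avg:
  assumes "A \<noteq> []"
  obtains B where "B \<noteq> []" "\<And>f :: 'a::ab_group_add \<Rightarrow> 'b::real_vector. (avg A ^^ k) f = avg B f"
proof (induction k arbitrary: thesis)
  case 0
  have "f = avg [0] f" for f :: "'a \<Rightarrow> 'b" by (auto simp: avg_def)
  then show ?case using 0[of "[0]"] by auto
next
  case (Suc k)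
  obtain B where B: "B \<noteq> []" "\<And>f :: 'a \<Rightarrow> 'b. (avg A ^^ k) f = avg B f" using Suc.IH by blast
  then have "(avg A ^^ Suc k) f = avg (concat (map (\<lambda>a. map ((+) a) B) A)) f" for f :: "'a \<Rightarrow> 'b"
    by (auto simp: avg_compose)
  moreover have "concat (map (\<lambda>a. map ((+) a) B) A) \<noteq> []" using B assms by (cases A) auto
  ultimately show ?case using Suc.prems by blast
qed

lemma avg_modulus:
  assumes "A \<noteq> []" "\<And>x. norm (f (u + x) - f x) \<le> \<epsilon>"
  shows "norm (avg A f (u + x) - avg A f x) \<le> (\<epsilon>::real)"
proof -
  have "avg A f (u + x) - avg A f x = avg A (\<lambda>x. f (u + x) - f x) x"
    unfolding avg_diff by (simp add: avg_def add.left_commute)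
  also have "norm \<dots> \<le> \<epsilon>" by (rule norm_avg_le) (use assms in auto)
  finally show ?thesis .
qed

lemma avg_bounds:
  fixes f :: "'a::ab_group_add \<Rightarrow> real"
  assumes "A \<noteq> []" "\<And>x. f x \<in> {l..h}"
  shows "avg A f x \<in> {l..h}"
proof -
  have "norm (avg A f x - (l + h) / 2) \<le> (h - l) / 2"
  proof (rule norm_avg_diff_le[OF assms(1)])
    show "norm (f x - (l + h) / 2) \<le> (h - l) / 2" for x
      unfolding real_norm_def
    proof (rule abs_leI)
      show "f x - (l + h) / 2 \<le> (h - l) / 2" "- (f x - (l + h) / 2) \<le> (h - l) / 2"
        using assms(2)[of x] by (simp_all add: field_simps)
    qed
  qed
  then show ?thesis by (auto simp: abs_le_iff field_simps)
qed

lemma avg_upper: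
  fixes f :: "'a::ab_group_add \<Rightarrow> real"
  assumes "a \<in> set A" "f (a + x) \<le> l" "\<And>x. f x \<le> h"
  shows "avg A f x \<le> h - (h - l) / length A"
proof -
  obtain B C where A: "A = B @ a # C" using assms(1) by (meson split_list)
  have *: "(\<Sum>a\<leftarrow>B. f (a + x)) \<le> length B * h" for B
    by (induction B) (auto simp: algebra_simps add_mono assms(3))
  have "(\<Sum>a\<leftarrow>A. f (a + x)) \<le> length A * h - (h - l)"
    using *[of B] *[of C] assms(2) by (simp add: A algebra_simps)
  moreover have "length A > 0" using A by simp
  ultimately show ?thesis by (simp add: avg_def field_simps)
qed

text \<open>
  If \<open>f\<close> falls below the middle of its range at some point \<open>y\<close>, every average contains a term taken near \<open>y\<close>,
  which pulls the upper bound down. If it never does, then the lower bound can be raised to the middle.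
\<close>
lemma avg_contracts_oscillation:
  fixes f :: "'a::ab_group_add \<Rightarrow> real"
  assumes f: "\<And>x. f x \<in> {l..l + d}" and d: "d \<ge> 0"
    and A: "\<And>z. \<exists>a\<in>set A. a - z \<in> U"
    and U: "\<And>u x. u \<in> U \<Longrightarrow> norm (f (u + x) - f x) \<le> d / 4"
  shows "\<exists>l'. \<forall>x. avg A f x \<in> {l'..l' + (1 - 1 / (4 * real (length A))) * d}"
proof (cases "\<exists>y. f y \<le> l + d / 2")
  case True
  then obtain y where y: "f y \<le> l + d / 2" by blast
  have Anz: "A \<noteq> []" using A[of 0] by auto
  have "avg A f x \<in> {l..l + (1 - 1 / (4 * real (length A))) * d}" for x
  proof -
    obtain a where a: "a \<in> set A" "a - (y - x) \<in> U" using A by blast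
    have "f (a + x) \<le> l + 3 * d / 4"
      using U[OF a(2), of y] y unfolding real_norm_def diff_add_cancel add_diff_cancel_left'
      by (simp add: algebra_simps del: le_divide_eq_numeral1 divide_le_eq_numeral1)
    then have "avg A f x \<le> (l + d) - ((l + d) - (l + 3 * d / 4)) / length A"
      by (rule avg_upper[OF a(1)]) (use f in auto)
    then show ?thesis using avg_bounds[OF Anz, of f l "l + d" x] f by (auto simp: field_simps)
  qed
  then show ?thesis by blast
next
  case False
  have Anz: "A \<noteq> []" using A[of 0] by auto
  then have "real (length A) \<ge> 1" by (cases A) auto
  then have "1 / (4 * real (length A)) \<le> 1 / 2" by (intro frac_le; linarith)
  then have *: "1 / (4 * real (length A)) * d \<le> 1 / 2 * d" using d by (intro mult_right_mono)
  have "f x \<in> {l + d / 2 .. l + d / 2 + (1 - 1 / (4 * real (length A))) * d}" for x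
    using f[of x] False * by (force simp: left_diff_distrib not_le less_imp_le)
  from avg_bounds[of A f, OF Anz this] show ?thesis by blast
qed

text \<open>
  Averaging preserves the modulus of continuity, so the contraction of the oscillation can be iterated with
  one and the same list \<open>A\<close>, which depends on the family only through its modulus. The contraction stops
  working at oscillation \<open>\<epsilon>\<close>, because the modulus is fixed at \<open>\<epsilon> / 4\<close>.
\<close>
lemma uniform_averages_nearly_constant_real:
  fixes \<Phi> :: "('a::topological_ab_group_add \<Rightarrow> real) set"
  assumes "compact (UNIV :: 'a set)" "equicontinuous \<Phi>"
    and B: "\<And>f x. f \<in> \<Phi> \<Longrightarrow> \<bar>f x\<bar> \<le> B" and "\<epsilon> > 0"
  obtains A where "A \<noteq> []" "\<And>f x y. f \<in> \<Phi> \<Longrightarrow> \<bar>avg A f x - avg A f y\<bar> \<le> \<epsilon>"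
proof -
  obtain U where U: "open U" "0 \<in> U"
    and Uf: "\<And>f u x. f \<in> \<Phi> \<Longrightarrow> u \<in> U \<Longrightarrow> norm (f (u + x) - f x) \<le> \<epsilon> / 4"
    using assms(2) \<open>\<epsilon> > 0\<close> unfolding equicontinuous_def by (metis divide_pos_pos zero_less_numeral)
  obtain A where Anz: "A \<noteq> []" and A: "\<And>z. \<exists>a\<in>set A. a - z \<in> U"
    using compact_cover_translates[OF assms(1) U] by blast
  define q where "q = 1 - 1 / (4 * real (length A))"
  have n: "real (length A) \<ge> 1" using Anz by (cases A) auto
  have "1 / (4 * real (length A)) \<le> 1" using n by (subst divide_le_eq_1) linarith
  then have q: "0 \<le> q" "q < 1" using n by (auto simp: q_def)
  \<comment> \<open>The width of an interval that contains all values after \<open>k\<close> rounds of averaging.\<close>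
  define w where "w k = max \<epsilon> (2 * B * q ^ k)" for k
  have step: "(\<forall>u\<in>U. \<forall>x. norm ((avg A ^^ k) f (u + x) - (avg A ^^ k) f x) \<le> \<epsilon> / 4) \<and>
     (\<exists>l. \<forall>x. (avg A ^^ k) f x \<in> {l..l + w k})" if f: "f \<in> \<Phi>" for f k
  proof (induction k)
    case 0
    have "f x \<in> {- B .. - B + w 0}" for x using B[OF f, of x] by (auto simp: w_def)
    then show ?case using Uf[OF f] by (auto intro!: exI[of _ "-B"])
  next
    case (Suc k)
    then obtain l where l: "\<And>x. (avg A ^^ k) f x \<in> {l..l + w k}" by blast
    have "\<epsilon> \<le> w k" by (simp add: w_def)
    have U': "norm ((avg A ^^ k) f (u + x) - (avg A ^^ k) f x) \<le> w k / 4" if "u \<in> U" for u x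
    proof -
      have "norm ((avg A ^^ k) f (u + x) - (avg A ^^ k) f x) \<le> \<epsilon> / 4" using Suc that by blast
      also have "\<dots> \<le> w k / 4" using \<open>\<epsilon> \<le> w k\<close> by linarith
      finally show ?thesis .
    qed
    have "0 \<le> w k" using \<open>\<epsilon> \<le> w k\<close> \<open>\<epsilon> > 0\<close> by linarith
    have "\<exists>l'. \<forall>x. avg A ((avg A ^^ k) f) x \<in> {l'..l' + q * w k}"
      unfolding q_def using U' by (intro avg_contracts_oscillation[OF l \<open>0 \<le> w k\<close> A])
    then obtain l' where l': "\<And>x. avg A ((avg A ^^ k) f) x \<in> {l'..l' + q * w k}"
      by blast
    have "q * w k \<le> w (Suc k)"
    proof -
      have "q * \<epsilon> \<le> \<epsilon>" using mult_right_mono[of q 1 \<epsilon>] q \<open>\<epsilon> > 0\<close> by linarith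
      moreover have "w k = \<epsilon> \<or> w k = 2 * B * q ^ k" by (simp add: w_def max_def)
      ultimately show ?thesis by (auto simp: w_def mult_ac)
    qed
    then have "\<forall>x. (avg A ^^ Suc k) f x \<in> {l'..l' + w (Suc k)}"
      using l' by (auto intro: order_trans[OF _ add_left_mono])
    moreover have "norm ((avg A ^^ Suc k) f (u + x) - (avg A ^^ Suc k) f x) \<le> \<epsilon> / 4" if "u \<in> U" for u x
      using avg_modulus[OF Anz, of "(avg A ^^ k) f" u "\<epsilon> / 4" x] Suc that by simp
    ultimately show ?case by blast
  qed
  have "(\<lambda>k. 2 * B * q ^ k) \<longlonglongrightarrow> 2 * B * 0"
    using q by (intro tendsto_mult tendsto_const LIMSEQ_power_zero) auto
  then have "eventually (\<lambda>k. 2 * B * q ^ k < \<epsilon>) sequentially"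
    using \<open>\<epsilon> > 0\<close> by (intro order_tendstoD(2)) auto
  then obtain k where "2 * B * q ^ k < \<epsilon>" by (auto simp: eventually_sequentially)
  then have "w k = \<epsilon>" by (simp add: w_def)
  obtain C where C: "C \<noteq> []" "\<And>f :: 'a \<Rightarrow> real. (avg A ^^ k) f = avg C f"
    using avg_funpow_eq_avg[OF Anz] by blast
  have "\<bar>avg C f x - avg C f y\<bar> \<le> \<epsilon>" if f: "f \<in> \<Phi>" for f x y
  proof -
    obtain l where "\<And>x. (avg A ^^ k) f x \<in> {l..l + \<epsilon>}"
      using step[OF f, of k] unfolding \<open>w k = \<epsilon>\<close> by blast
    then have "avg C f x \<in> {l..l + \<epsilon>}" "avg C f y \<in> {l..l + \<epsilon>}" unfolding C(2) by blast+
    then show ?thesis by auto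
  qed
  with C(1) show ?thesis using that by blast
qed

lemma uniform_averages_nearly_constant:
  fixes \<Phi> :: "('a::topological_ab_group_add \<Rightarrow> complex) set"
  assumes "compact (UNIV :: 'a set)" "equicontinuous \<Phi>"
    and B: "\<And>f x. f \<in> \<Phi> \<Longrightarrow> norm (f x) \<le> B" and "\<epsilon> > 0"
  obtains A where "A \<noteq> []" "\<And>f x y. f \<in> \<Phi> \<Longrightarrow> norm (avg A f x - avg A f y) \<le> \<epsilon>"
proof -
  let ?\<Psi> = "(\<lambda>f x. Re (f x)) ` \<Phi> \<union> (\<lambda>f x. Im (f x)) ` \<Phi>"
  have "norm (Re x - Re y) \<le> norm (x - y)" "norm (Im x - Im y) \<le> norm (x - y)" for x y
    using abs_Re_le_cmod[of "x - y"] abs_Im_le_cmod[of "x - y"] by auto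
  then have "equicontinuous ?\<Psi>"
    by (intro equicontinuous_Un equicontinuous_contraction assms)
  moreover have "\<bar>f x\<bar> \<le> B" if "f \<in> ?\<Psi>" for f x
    using that by (auto intro: order_trans[OF abs_Re_le_cmod B] order_trans[OF abs_Im_le_cmod B])
  ultimately obtain A where A: "A \<noteq> []" "\<And>f x y. f \<in> ?\<Psi> \<Longrightarrow> \<bar>avg A f x - avg A f y\<bar> \<le> \<epsilon> / 2"
    using uniform_averages_nearly_constant_real[OF assms(1), of ?\<Psi> B "\<epsilon> / 2"] \<open>\<epsilon> > 0\<close> by (metis half_gt_zero)
  have "norm (avg A f x - avg A f y) \<le> \<epsilon>" if "f \<in> \<Phi>" for f x y
  proof -
    have "linear Re" "linear Im" by (auto intro: bounded_linear.linear bounded_linear_Re bounded_linear_Im)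
    then have "\<bar>Re (avg A f x - avg A f y)\<bar> \<le> \<epsilon> / 2" "\<bar>Im (avg A f x - avg A f y)\<bar> \<le> \<epsilon> / 2"
      using A(2)[of "\<lambda>x. Re (f x)" x y] A(2)[of "\<lambda>x. Im (f x)" x y] that by (auto simp: avg_linear)
    then show ?thesis using cmod_le[of "avg A f x - avg A f y"] by linarith
  qed
  with A(1) show ?thesis using that by blast
qed

section \<open>The invariant mean\<close>

definition is_mean :: "('a::ab_group_add \<Rightarrow> complex) \<Rightarrow> complex \<Rightarrow> bool" where
  "is_mean f c \<longleftrightarrow> (\<forall>\<epsilon>>0. \<exists>A. A \<noteq> [] \<and> (\<forall>x. norm (avg A f x - c) \<le> \<epsilon>))"

definition mean :: "('a::ab_group_add \<Rightarrow> complex) \<Rightarrow> complex" where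
  "mean f = (THE c. is_mean f c)"

lemma is_mean_unique: "is_mean f c \<Longrightarrow> is_mean f d \<Longrightarrow> c = d"
proof (rule ccontr)
  assume *: "is_mean f c" "is_mean f d" "c \<noteq> d"
  define \<epsilon> where "\<epsilon> = norm (c - d) / 3"
  have "\<epsilon> > 0" using * by (simp add: \<epsilon>_def)
  then obtain A B where "A \<noteq> []" "\<And>x. norm (avg A f x - c) \<le> \<epsilon>" "B \<noteq> []" "\<And>x. norm (avg B f x - d) \<le> \<epsilon>"
    using * unfolding is_mean_def by meson
  then have "norm (c - d) \<le> \<epsilon> + \<epsilon>" by (rule avg_constants_close)
  then show False using \<open>\<epsilon> > 0\<close> by (simp add: \<epsilon>_def)
qed

lemma mean_eqI: "is_mean f c \<Longrightarrow> mean f = c"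
  unfolding mean_def using is_mean_unique by blast

lemma compact_bounded_continuous:
  fixes f :: "'a::topological_space \<Rightarrow> 'b::real_normed_vector"
  assumes "compact (UNIV :: 'a set)" "continuous_on UNIV f"
  obtains B where "\<And>x. norm (f x) \<le> B"
  using compact_imp_bounded[OF compact_continuous_image[OF assms(2,1)]] by (auto simp: bounded_iff)

text \<open>
  Constants approximated to within \<open>1 / (n + 1)\<close> form a Cauchy sequence, because averages over different
  lists commute.
\<close>
lemma is_mean_mean:
  fixes f :: "'a::topological_ab_group_add \<Rightarrow> complex"
  assumes "compact (UNIV :: 'a set)" "continuous_on UNIV f"
  shows "is_mean f (mean f)"
proof -
  obtain B where B: "\<And>x. norm (f x) \<le> B" using compact_bounded_continuous[OF assms] by blast
  have "\<exists>A. A \<noteq> [] \<and> (\<forall>x y. norm (avg A f x - avg A f y) \<le> 1 / Suc n)" for n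
    using uniform_averages_nearly_constant[OF assms(1) equicontinuous_single[OF assms], of B "1 / Suc n"] B
    by (metis divide_pos_pos of_nat_0_less_iff singleton_iff zero_less_Suc zero_less_one)
  then obtain A where Anz: "\<And>n. A n \<noteq> []"
    and A: "\<And>n x y. norm (avg (A n) f x - avg (A n) f y) \<le> 1 / Suc n" by metis
  define c where "c n = avg (A n) f 0" for n
  have close: "norm (c m - c n) \<le> 1 / Suc m + 1 / Suc n" for m n
    using avg_constants_close[OF Anz A Anz A] unfolding c_def .
  have lim0: "(\<lambda>n. 1 / real (Suc n)) \<longlonglongrightarrow> 0" by (rule LIMSEQ_inverse_real_of_nat[unfolded inverse_eq_divide])
  have "Cauchy c"
  proof (rule metric_CauchyI)
    fix e :: real assume "e > 0"
    then have "eventually (\<lambda>n. 1 / real (Suc n) < e / 2) sequentially"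
      using lim0 by (intro order_tendstoD(2)) auto
    then obtain N where N: "\<And>n. n \<ge> N \<Longrightarrow> 1 / real (Suc n) < e / 2" by (auto simp: eventually_sequentially)
    have "dist (c m) (c n) < e" if "m \<ge> N" "n \<ge> N" for m n
      using close[of m n] N[OF that(1)] N[OF that(2)] unfolding dist_norm by linarith
    then show "\<exists>M. \<forall>m\<ge>M. \<forall>n\<ge>M. dist (c m) (c n) < e" by blast
  qed
  then obtain d where d: "c \<longlonglongrightarrow> d" using Cauchy_convergent convergent_def by blast
  have cd: "norm (c n - d) \<le> 1 / Suc n" for n
  proof (rule LIMSEQ_le)
    show "(\<lambda>m. norm (c n - c m)) \<longlonglongrightarrow> norm (c n - d)" by (intro tendsto_intros d)
    show "(\<lambda>m. 1 / Suc n + 1 / real (Suc m)) \<longlonglongrightarrow> 1 / Suc n"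
      using tendsto_add[OF tendsto_const lim0, of "1 / Suc n"] by simp
  qed (use close in auto)
  have "is_mean f d"
    unfolding is_mean_def
  proof (intro allI impI)
    fix \<epsilon> :: real assume "\<epsilon> > 0"
    then have "eventually (\<lambda>n. 1 / real (Suc n) < \<epsilon> / 2) sequentially"
      using lim0 by (intro order_tendstoD(2)) auto
    then obtain n where n: "1 / real (Suc n) < \<epsilon> / 2" by (auto simp: eventually_sequentially)
    have "norm (avg (A n) f x - d) \<le> \<epsilon>" for x
    proof -
      have "norm (avg (A n) f x - d) \<le> norm (avg (A n) f x - c n) + norm (c n - d)"
        by (rule norm_triangle_sub[of "avg (A n) f x - d" "c n - d", simplified, THEN order_trans]) simp
      then show ?thesis using n cd[of n] A[of n x 0] unfolding c_def by linarith
    qed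
    then show "\<exists>A. A \<noteq> [] \<and> (\<forall>x. norm (avg A f x - d) \<le> \<epsilon>)" using Anz by blast
  qed
  then show ?thesis using mean_eqI by metis
qed

text \<open>
  A single list of translates computes the means of a whole equicontinuous family up to \<open>\<epsilon>\<close>. This
  uniformity is the source of the Fubini law.
\<close>
lemma uniform_mean:
  fixes \<Phi> :: "('a::topological_ab_group_add \<Rightarrow> complex) set"
  assumes "compact (UNIV :: 'a set)" "equicontinuous \<Phi>"
    and c: "\<And>f. f \<in> \<Phi> \<Longrightarrow> continuous_on UNIV f"
    and B: "\<And>f x. f \<in> \<Phi> \<Longrightarrow> norm (f x) \<le> B" and "\<epsilon> > 0"
  obtains A where "A \<noteq> []" "\<And>f x. f \<in> \<Phi> \<Longrightarrow> norm (avg A f x - mean f) \<le> \<epsilon>"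
proof -
  obtain A where A: "A \<noteq> []" "\<And>f x y. f \<in> \<Phi> \<Longrightarrow> norm (avg A f x - avg A f y) \<le> \<epsilon>"
    using uniform_averages_nearly_constant[OF assms(1,2), of B \<epsilon>] B \<open>\<epsilon> > 0\<close> by blast
  have "norm (avg A f x - mean f) \<le> \<epsilon>" if f: "f \<in> \<Phi>" for f x
  proof (rule field_le_epsilon)
    fix e :: real assume "e > 0"
    then obtain C where "C \<noteq> []" "\<And>x. norm (avg C f x - mean f) \<le> e"
      using is_mean_mean[OF assms(1) c[OF f]] unfolding is_mean_def by blast
    then show "norm (avg A f x - mean f) \<le> \<epsilon> + e"
      using avg_constants_close[OF A(1) A(2)[OF f]] by blast
  qed
  with A(1) show ?thesis using that by blast
qed

section \<open>Convolution, adjoints and projections\<close>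

definition conv :: "('a::ab_group_add \<Rightarrow> complex) \<Rightarrow> ('a \<Rightarrow> complex) \<Rightarrow> 'a \<Rightarrow> complex" where
  "conv u v x = mean (\<lambda>y. u (x - y) * v y)"

definition adj :: "('a::ab_group_add \<Rightarrow> complex) \<Rightarrow> 'a \<Rightarrow> complex" where
  "adj u x = cnj (u (- x))"

text \<open>
  The square of the norm in \<open>L\<^sup>2\<close> of the invariant mean.
\<close>
definition sqnorm :: "('a::ab_group_add \<Rightarrow> complex) \<Rightarrow> real" where
  "sqnorm u = Re (mean (\<lambda>x. of_real ((cmod (u x))\<^sup>2)))"

text \<open>
  The convolution algebra need not have a unit, so the powers start at exponent \<open>1\<close>: \<open>cpow k n\<close> is the
  \<open>(n + 1)\<close>-fold convolution power of \<open>k\<close>.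
\<close>
primrec cpow :: "('a::ab_group_add \<Rightarrow> complex) \<Rightarrow> nat \<Rightarrow> 'a \<Rightarrow> complex" where
  "cpow k 0 = k"
| "cpow k (Suc n) = conv k (cpow k n)"

text \<open>
  Convolution with such a \<open>p\<close> is an orthogonal projection; its range is a translation-invariant space of
  finite dimension \<open>sqnorm p\<close>.
\<close>
definition projection :: "('a::topological_ab_group_add \<Rightarrow> complex) \<Rightarrow> bool" where
  "projection p \<longleftrightarrow> continuous_on UNIV p \<and> adj p = p \<and> conv p p = p \<and> p \<noteq> (\<lambda>_. 0)"

lemma adj_adj [simp]: "adj (adj u) = u"
  by (rule ext) (simp add: adj_def)

lemma continuous_on_adj:
  fixes u :: "'a::topological_ab_group_add \<Rightarrow> complex"
  assumes "continuous_on UNIV u"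
  shows "continuous_on UNIV (adj u)"
  unfolding adj_def[abs_def] by (intro continuous_intros continuous_on_UNIV_compose[OF assms])

section \<open>A growth lemma for real sequences\<close>

text \<open>
  Log-convexity makes the quotients \<open>a (n + 1) / a n\<close> increase to a limit \<open>\<rho>\<close>, so \<open>a n / \<rho>\<^sup>n\<^sup>+\<^sup>1\<close> decreases.
  Submultiplicativity keeps the normalized sequence at least \<open>1\<close>: with \<open>r\<close> the quotient at \<open>n\<close>,
  \<open>r\<^sup>m\<^sup>+\<^sup>1 a n \<le> a (n + m + 1) \<le> a m \<cdot> a n\<close>, and \<open>r\<close> tends to \<open>\<rho>\<close>.
\<close>
lemma logconvex_submultiplicative_growth:
  fixes a :: "nat \<Rightarrow> real"
  assumes pos: "\<And>n. a n > 0"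
    and lc: "\<And>n. (a (n + 1))\<^sup>2 \<le> a n * a (n + 2)"
    and sm: "\<And>m n. a (m + n + 1) \<le> a m * a n"
  obtains \<rho> L where "\<rho> > 0" "L \<ge> 1" "(\<lambda>n. a n / \<rho> ^ (n + 1)) \<longlonglongrightarrow> L"
proof -
  define r where "r n = a (n + 1) / a n" for n
  have rpos: "r n > 0" for n using pos by (simp add: r_def)
  have "incseq r"
  proof (rule incseq_SucI)
    show "r n \<le> r (Suc n)" for n
      using lc[of n] pos[of n] pos[of "n + 1"] by (simp add: r_def field_simps power2_eq_square)
  qed
  moreover have "r n \<le> a 0" for n
    using sm[of n 0] pos[of n] by (simp add: r_def field_simps)
  ultimately obtain \<rho> where \<rho>: "r \<longlonglongrightarrow> \<rho>" "\<And>n. r n \<le> \<rho>"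
    using incseq_convergent[of r "a 0"] by blast
  have "\<rho> > 0" using rpos[of 0] \<rho>(2)[of 0] by linarith
  have growth: "r n ^ j * a n \<le> a (n + j)" for n j
  proof (induction j)
    case (Suc j)
    have "r n ^ Suc j * a n = r n * (r n ^ j * a n)" by simp
    also have "\<dots> \<le> r (n + j) * a (n + j)"
      using Suc rpos[of n] rpos[of "n + j"] pos[of n] \<open>incseq r\<close> by (intro mult_mono) (auto simp: incseq_def less_imp_le)
    also have "\<dots> = a (n + Suc j)" using pos[of "n + j"] by (simp add: r_def)
    finally show ?case .
  qed simp
  have "r n ^ (m + 1) \<le> a m" for m n
  proof -
    have "r n ^ (m + 1) * a n \<le> a m * a n"
      using growth[of n "m + 1"] sm[of m n] by (simp add: add_ac)
    then show ?thesis using pos[of n] by simp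
  qed
  moreover have "(\<lambda>n. r n ^ (m + 1)) \<longlonglongrightarrow> \<rho> ^ (m + 1)" for m by (intro tendsto_intros \<rho>)
  ultimately have lb: "\<rho> ^ (m + 1) \<le> a m" for m
    by (intro LIMSEQ_le_const2[of "\<lambda>n. r n ^ (m + 1)"]) auto
  define b where "b n = a n / \<rho> ^ (n + 1)" for n
  have b1: "b n \<ge> 1" for n using lb[of n] \<open>\<rho> > 0\<close> by (simp add: b_def)
  have "decseq b"
  proof (rule decseq_SucI)
    show "b (Suc n) \<le> b n" for n
      using \<rho>(2)[of n] pos[of n] \<open>\<rho> > 0\<close> by (simp add: b_def r_def field_simps)
  qed
  then obtain L where L: "b \<longlonglongrightarrow> L" using decseq_convergent[of b 1] b1 by blast
  moreover have "L \<ge> 1" using LIMSEQ_le_const[OF L] b1 by blast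
  ultimately show ?thesis using that[of \<rho> L] \<open>\<rho> > 0\<close> unfolding b_def by blast
qed

section \<open>Linearity, positivity and the Fubini law\<close>

context
  assumes compact_UNIV: "compact (UNIV :: 'a::topological_ab_group_add set)"
begin

lemma mean_approx:
  fixes f :: "'a \<Rightarrow> complex"
  assumes "continuous_on UNIV f" "continuous_on UNIV h" "\<epsilon> > 0"
  obtains A where "A \<noteq> []" "\<And>x. norm (avg A f x - mean f) \<le> \<epsilon>" "\<And>x. norm (avg A h x - mean h) \<le> \<epsilon>"
proof -
  obtain B1 B2 where "\<And>x. norm (f x) \<le> B1" "\<And>x. norm (h x) \<le> B2"
    using compact_bounded_continuous[OF compact_UNIV] assms by metis
  then have B: "\<And>k x. k \<in> {f} \<union> {h} \<Longrightarrow> norm (k x) \<le> max B1 B2" by (auto simp: le_max_iff_disj)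
  have e: "equicontinuous ({f} \<union> {h})"
    by (intro equicontinuous_Un equicontinuous_single compact_UNIV assms)
  have c: "\<And>k. k \<in> {f} \<union> {h} \<Longrightarrow> continuous_on UNIV k" using assms by auto
  show ?thesis
    by (rule uniform_mean[OF compact_UNIV e c, of "max B1 B2" \<epsilon>]) (use that B \<open>\<epsilon> > 0\<close> in auto)
qed

lemma mean_add:
  fixes f :: "'a \<Rightarrow> complex"
  assumes "continuous_on UNIV f" "continuous_on UNIV h"
  shows "mean (\<lambda>x. f x + h x) = mean f + mean h"
proof (rule mean_eqI, unfold is_mean_def, intro allI impI)
  fix \<epsilon> :: real assume "\<epsilon> > 0"
  then obtain A where A: "A \<noteq> []" "\<And>x. norm (avg A f x - mean f) \<le> \<epsilon> / 2" "\<And>x. norm (avg A h x - mean h) \<le> \<epsilon> / 2"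
    using mean_approx[OF assms, of "\<epsilon> / 2"] by (metis half_gt_zero)
  have "norm (avg A (\<lambda>x. f x + h x) x - (mean f + mean h)) \<le> \<epsilon>" for x
    using norm_diff_triangle_ineq[of "avg A f x" "avg A h x" "mean f" "mean h"] A(2)[of x] A(3)[of x]
    unfolding avg_add by linarith
  with A(1) show "\<exists>A. A \<noteq> [] \<and> (\<forall>x. norm (avg A (\<lambda>x. f x + h x) x - (mean f + mean h)) \<le> \<epsilon>)" by blast
qed

lemma mean_bounded_linear:
  fixes f :: "'a \<Rightarrow> complex"
  assumes "bounded_linear L" "continuous_on UNIV f"
  shows "mean (\<lambda>x. L (f x)) = L (mean f)"
proof (rule mean_eqI, unfold is_mean_def, intro allI impI)
  interpret bounded_linear L by fact
  obtain K where K: "K > 0" "\<And>x. norm (L x) \<le> norm x * K" using pos_bounded by blast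
  fix \<epsilon> :: real assume "\<epsilon> > 0"
  then have "\<epsilon> / K > 0" using K by simp
  then obtain A where A: "A \<noteq> []" "\<And>x. norm (avg A f x - mean f) \<le> \<epsilon> / K"
    using mean_approx[OF assms(2,2)] by metis
  have "norm (avg A (\<lambda>x. L (f x)) x - L (mean f)) \<le> \<epsilon>" for x
  proof -
    have "norm (avg A (\<lambda>x. L (f x)) x - L (mean f)) = norm (L (avg A f x - mean f))"
      by (simp add: avg_linear linear_axioms diff)
    also have "\<dots> \<le> (\<epsilon> / K) * K" using K(1) A(2) by (intro order_trans[OF K(2)] mult_right_mono) auto
    finally show ?thesis using K(1) by simp
  qed
  with A(1) show "\<exists>A. A \<noteq> [] \<and> (\<forall>x. norm (avg A (\<lambda>x. L (f x)) x - L (mean f)) \<le> \<epsilon>)" by blast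
qed

lemmas mean_cmult = mean_bounded_linear[OF bounded_linear_mult_right]
lemmas mean_cnj = mean_bounded_linear[OF bounded_linear_cnj]

lemma mean_uminus:
  fixes f :: "'a \<Rightarrow> complex"
  shows "continuous_on UNIV f \<Longrightarrow> mean (\<lambda>x. - f x) = - mean f"
  by (rule mean_bounded_linear[OF bounded_linear_minus[OF bounded_linear_ident]])

lemma mean_diff:
  fixes f :: "'a \<Rightarrow> complex"
  assumes "continuous_on UNIV f" "continuous_on UNIV h"
  shows "mean (\<lambda>x. f x - h x) = mean f - mean h"
  using mean_add[OF assms(1), of "\<lambda>x. - h x"] assms by (simp add: mean_uminus continuous_on_minus)

lemma mean_const: "mean (\<lambda>x::'a. c) = c"
  by (rule mean_eqI) (auto simp: is_mean_def avg_const intro!: exI[of _ "[0]"])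

lemma mean_sum_list:
  fixes F :: "'b \<Rightarrow> 'a \<Rightarrow> complex"
  assumes "\<And>a. continuous_on UNIV (F a)"
  shows "mean (\<lambda>x. \<Sum>a\<leftarrow>A. F a x) = (\<Sum>a\<leftarrow>A. mean (F a))"
proof (induction A)
  case Nil
  then show ?case by (simp add: mean_const)
next
  case (Cons a A)
  have "continuous_on UNIV (\<lambda>x. \<Sum>a\<leftarrow>A. F a x)"
    by (induction A) (auto intro!: continuous_intros assms)
  with Cons show ?case by (simp add: mean_add assms)
qed

lemma mean_translate:
  fixes f :: "'a \<Rightarrow> complex"
  assumes "continuous_on UNIV f"
  shows "mean (\<lambda>x. f (a + x)) = mean f"
proof (rule mean_eqI, unfold is_mean_def, intro allI impI)
  fix \<epsilon> :: real assume "\<epsilon> > 0"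
  then obtain A where A: "A \<noteq> []" "\<And>x. norm (avg A f x - mean f) \<le> \<epsilon>"
    using mean_approx[OF assms assms] by metis
  have "avg A (\<lambda>x. f (a + x)) x = avg A f (a + x)" for x by (simp add: avg_def add.left_commute)
  with A show "\<exists>A. A \<noteq> [] \<and> (\<forall>x. norm (avg A (\<lambda>x. f (a + x)) x - mean f) \<le> \<epsilon>)" by auto
qed

lemma mean_reflect:
  fixes f :: "'a \<Rightarrow> complex"
  assumes "continuous_on UNIV f"
  shows "mean (\<lambda>x. f (- x)) = mean f"
proof (rule mean_eqI, unfold is_mean_def, intro allI impI)
  fix \<epsilon> :: real assume "\<epsilon> > 0"
  then obtain A where A: "A \<noteq> []" "\<And>x. norm (avg A f x - mean f) \<le> \<epsilon>"
    using mean_approx[OF assms assms] by metis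
  have "avg (map uminus A) (\<lambda>x. f (- x)) x = avg A f (- x)" for x by (simp add: avg_def o_def)
  with A show "\<exists>A. A \<noteq> [] \<and> (\<forall>x. norm (avg A (\<lambda>x. f (- x)) x - mean f) \<le> \<epsilon>)"
    by (intro exI[of _ "map uminus A"]) auto
qed

lemma mean_reflect_translate:
  fixes f :: "'a \<Rightarrow> complex"
  assumes "continuous_on UNIV f"
  shows "mean (\<lambda>x. f (a - x)) = mean f"
proof -
  have "continuous_on UNIV (\<lambda>x. f (a + x))" by (intro continuous_on_UNIV_compose[OF assms] continuous_intros)
  then have "mean (\<lambda>x. f (a + - x)) = mean (\<lambda>x. f (a + x))" by (rule mean_reflect)
  then show ?thesis by (simp add: mean_translate[OF assms])
qed

lemma norm_mean_le:
  fixes f :: "'a \<Rightarrow> complex"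
  assumes "continuous_on UNIV f" "continuous_on UNIV r" "\<And>x. norm (f x) \<le> r x"
  shows "norm (mean f) \<le> Re (mean (\<lambda>x. of_real (r x)))"
proof (rule field_le_epsilon)
  fix e :: real assume "e > 0"
  let ?r = "\<lambda>x. complex_of_real (r x)"
  have "continuous_on UNIV ?r" using assms by (intro continuous_intros)
  then obtain A where A: "A \<noteq> []" "\<And>x. norm (avg A f x - mean f) \<le> e / 2"
    "\<And>x. norm (avg A ?r x - mean ?r) \<le> e / 2"
    using mean_approx[OF assms(1), of ?r "e / 2"] \<open>e > 0\<close> by (metis half_gt_zero)
  have "norm (\<Sum>a\<leftarrow>A. f (a + 0)) \<le> (\<Sum>a\<leftarrow>A. r (a + 0))"
    by (induction A) (auto intro!: order_trans[OF norm_triangle_ineq] add_mono assms)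
  then have "norm (avg A f 0) \<le> avg A r 0"
    by (simp add: avg_def mult_left_mono)
  moreover have "avg A ?r 0 = of_real (avg A r 0)"
    by (rule avg_linear) (auto intro: bounded_linear.linear bounded_linear_of_real)
  moreover have "norm (mean f) \<le> norm (avg A f 0) + e / 2"
    using norm_triangle_ineq2[of "mean f" "avg A f 0"] A(2)[of 0] by (simp add: norm_minus_commute)
  moreover have "avg A r 0 \<le> Re (mean ?r) + e / 2"
    using complex_Re_le_cmod[of "avg A ?r 0 - mean ?r"] A(3)[of 0] calculation(2) by simp
  ultimately show "norm (mean f) \<le> Re (mean ?r) + e" by simp
qed

lemma norm_mean_le_const:
  fixes f :: "'a \<Rightarrow> complex"
  assumes "continuous_on UNIV f" "\<And>x. norm (f x) \<le> B"
  shows "norm (mean f) \<le> B"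
  using norm_mean_le[OF assms(1), of "\<lambda>_. B"] assms(2) by (simp add: mean_const)

lemma mean_of_real_Reals:
  fixes r :: "'a \<Rightarrow> real"
  assumes "continuous_on UNIV r"
  shows "mean (\<lambda>x. of_real (r x)) = of_real (Re (mean (\<lambda>x. of_real (r x))))"
  using mean_cnj[of "\<lambda>x. of_real (r x)"] assms
  by (simp add: complex_eq_iff continuous_on_of_real)

text \<open>
  By compactness finitely many translates of \<open>r\<close> have a sum that is bounded below by a positive constant,
  and all of them have the same mean.
\<close>
lemma mean_pos:
  fixes r :: "'a \<Rightarrow> real"
  assumes r: "continuous_on UNIV r" "\<And>x. r x \<ge> 0" and "r x0 > 0"
  shows "Re (mean (\<lambda>x. of_real (r x))) > 0"
proof -
  define U where "U = {u. r (u + x0) > r x0 / 2}"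
  have "open U" unfolding U_def
    by (intro open_Collect_less continuous_intros continuous_on_UNIV_compose[OF r(1)])
  moreover have "0 \<in> U" using \<open>r x0 > 0\<close> by (simp add: U_def)
  ultimately obtain A where A: "A \<noteq> []" "\<And>z. \<exists>a\<in>set A. a - z \<in> U"
    using compact_cover_translates[OF compact_UNIV] by blast
  let ?s = "\<lambda>x. \<Sum>a\<leftarrow>A. r (a + x)"
  have c: "continuous_on UNIV (\<lambda>x. r (a + x))" for a
    by (intro continuous_intros continuous_on_UNIV_compose[OF r(1)])
  then have cs: "continuous_on UNIV ?s"
    by (induction A) (auto intro!: continuous_intros)
  have "r x0 / 2 \<le> ?s x" for x
  proof -
    obtain a where a: "a \<in> set A" "a - (x0 - x) \<in> U" using A(2) by blast
    then have "r x0 / 2 \<le> r (a + x)" by (simp add: U_def)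
    also have "\<dots> \<le> ?s x" using a(1) r(2) by (intro member_le_sum_list) auto
    finally show ?thesis .
  qed
  then have "norm (mean (\<lambda>x::'a. of_real (r x0 / 2))) \<le> Re (mean (\<lambda>x. of_real (?s x)))"
    using \<open>r x0 > 0\<close> by (intro norm_mean_le cs continuous_intros) auto
  moreover have "mean (\<lambda>x. of_real (?s x)) = (\<Sum>a\<leftarrow>A. mean (\<lambda>x. of_real (r (a + x))))"
  proof -
    have "complex_of_real (?s x) = (\<Sum>a\<leftarrow>A. of_real (r (a + x)))" for x by (induction A) auto
    then show ?thesis using mean_sum_list[of "\<lambda>a x. of_real (r (a + x))" A] c
      by (simp add: continuous_on_of_real)
  qed
  moreover have "\<dots> = of_nat (length A) * mean (\<lambda>x. of_real (r x))"
  proof -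
    have "continuous_on UNIV (\<lambda>x. complex_of_real (r x))" by (intro continuous_intros r)
    from mean_translate[OF this] show ?thesis by (simp add: sum_list_triv)
  qed
  ultimately have "0 < real (length A) * Re (mean (\<lambda>x. of_real (r x)))"
    using \<open>r x0 > 0\<close> by (simp add: mean_const)
  then show ?thesis by (simp add: zero_less_mult_iff)
qed

lemma continuous_on_mean:
  fixes F :: "'b::topological_space \<Rightarrow> 'a \<Rightarrow> complex"
  assumes F: "continuous_on UNIV (\<lambda>(x, y). F x y)"
  shows "continuous_on UNIV (\<lambda>x. mean (F x))"
  unfolding continuous_on_def
proof (intro ballI tendstoI)
  fix x0 :: 'b and e :: real assume "e > 0"
  have c: "continuous_on UNIV (F x)" for x by (rule continuous_on_section[OF F])
  define W where "W = {p. norm (F (fst p) (snd p) - F x0 (snd p)) < e / 2}"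
  have "continuous_on UNIV (\<lambda>p. F (fst p) (snd p))" using F by (simp add: case_prod_unfold)
  then have "open W" unfolding W_def
    by (intro open_Collect_less continuous_intros continuous_on_UNIV_compose[OF c])
  moreover have "{x0} \<times> UNIV \<subseteq> W" using \<open>e > 0\<close> by (auto simp: W_def)
  ultimately obtain X where X: "x0 \<in> X" "open X" "X \<times> UNIV \<subseteq> W"
    using tube_lemma[OF compact_UNIV, of W x0] by blast
  have "dist (mean (F x)) (mean (F x0)) < e" if "x \<in> X" for x
  proof -
    have "norm (mean (\<lambda>y. F x y - F x0 y)) \<le> e / 2"
    proof (rule norm_mean_le_const)
      show "norm (F x y - F x0 y) \<le> e / 2" for y
        using subsetD[OF X(3), of "(x, y)"] that by (simp add: W_def)
    qed (intro continuous_intros c)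
    then show ?thesis using \<open>e > 0\<close> by (simp add: dist_norm mean_diff c)
  qed
  then show "eventually (\<lambda>x. dist (mean (F x)) (mean (F x0)) < e) (at x0 within UNIV)"
    using X(1,2) by (auto simp: eventually_at_topological)
qed

text \<open>
  The sections \<open>F x\<close> form an equicontinuous family, so one list \<open>A\<close> averages all of them to their means.
  Averaging over \<open>A\<close> is a finite sum and commutes with the mean in \<open>x\<close>.
\<close>
lemma mean_swap:
  fixes F :: "'a \<Rightarrow> 'a \<Rightarrow> complex"
  assumes F: "continuous_on UNIV (\<lambda>(x, y). F x y)"
  shows "mean (\<lambda>x. mean (\<lambda>y. F x y)) = mean (\<lambda>y. mean (\<lambda>x. F x y))"
proof (rule sym, rule mean_eqI, unfold is_mean_def, intro allI impI)
  have cF: "continuous_on UNIV (\<lambda>p. F (fst p) (snd p))" using F by (simp add: case_prod_unfold)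
  have c1: "continuous_on UNIV (F x)" for x by (rule continuous_on_section[OF F])
  have c2: "continuous_on UNIV (\<lambda>x. F x y)" for y
    using continuous_on_UNIV_compose[OF cF, of UNIV "\<lambda>x. (x, y)"] by (simp add: continuous_intros)
  obtain B where B: "\<And>p. norm (F (fst p) (snd p)) \<le> B"
    using compact_bounded_continuous[OF _ cF] compact_Times[OF compact_UNIV compact_UNIV]
    by (metis UNIV_Times_UNIV)
  fix \<epsilon> :: real assume "\<epsilon> > 0"
  have e: "equicontinuous (range F)"
    by (rule equicontinuous_sections[OF compact_UNIV compact_UNIV F])
  obtain A where A: "A \<noteq> []" "\<And>f x. f \<in> range F \<Longrightarrow> norm (avg A f x - mean f) \<le> \<epsilon>"
  proof (rule uniform_mean[OF compact_UNIV e _ _ \<open>\<epsilon> > 0\<close>])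
    show "norm (f x) \<le> B" if "f \<in> range F" for f x using that B[of "(y, x)" for y] by auto
  qed (use c1 in auto)
  have "norm (avg A (\<lambda>y. mean (\<lambda>x. F x y)) y - mean (\<lambda>x. mean (F x))) \<le> \<epsilon>" for y
  proof -
    have ca: "continuous_on UNIV (\<lambda>x. avg A (F x) y)"
    proof -
      have "continuous_on UNIV (\<lambda>x. \<Sum>a\<leftarrow>A. F x (a + y))"
        by (induction A) (auto intro!: continuous_intros c2)
      then show ?thesis unfolding avg_def by (intro continuous_intros)
    qed
    have "mean (\<lambda>x. avg A (F x) y) = avg A (\<lambda>y. mean (\<lambda>x. F x y)) y"
    proof -
      have "continuous_on UNIV (\<lambda>x. \<Sum>a\<leftarrow>A. F x (a + y))"
        by (induction A) (auto intro!: continuous_intros c2)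
      then have "mean (\<lambda>x. avg A (F x) y) = mean (\<lambda>x. \<Sum>a\<leftarrow>A. F x (a + y)) /\<^sub>R length A"
        unfolding avg_def by (intro mean_bounded_linear[OF bounded_linear_scaleR_right])
      also have "mean (\<lambda>x. \<Sum>a\<leftarrow>A. F x (a + y)) = (\<Sum>a\<leftarrow>A. mean (\<lambda>x. F x (a + y)))"
        by (rule mean_sum_list) (rule c2)
      finally show ?thesis by (simp add: avg_def)
    qed
    then have "avg A (\<lambda>y. mean (\<lambda>x. F x y)) y - mean (\<lambda>x. mean (F x)) = mean (\<lambda>x. avg A (F x) y - mean (F x))"
      by (simp add: mean_diff ca continuous_on_mean[OF F])
    also have "norm \<dots> \<le> \<epsilon>"
      by (rule norm_mean_le_const) (use A(2) in \<open>auto intro!: continuous_intros ca continuous_on_mean[OF F]\<close>)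
    finally show ?thesis .
  qed
  with A(1) show "\<exists>A. A \<noteq> [] \<and> (\<forall>y. norm (avg A (\<lambda>y. mean (\<lambda>x. F x y)) y - mean (\<lambda>x. mean (F x))) \<le> \<epsilon>)" by blast
qed

section \<open>The convolution algebra\<close>

lemma continuous_on_conv_kernel:
  fixes u v :: "'a \<Rightarrow> complex"
  assumes "continuous_on UNIV u" "continuous_on UNIV v"
  shows "continuous_on UNIV (\<lambda>(x, y). u (x - y) * v y)"
  unfolding case_prod_unfold
  by (intro continuous_intros continuous_on_UNIV_compose[OF assms(1)] continuous_on_UNIV_compose[OF assms(2)])

lemma continuous_on_conv_integrand:
  fixes u v :: "'a \<Rightarrow> complex"
  assumes "continuous_on UNIV u" "continuous_on UNIV v"
  shows "continuous_on UNIV (\<lambda>y. u (x - y) * v y)"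
  by (intro continuous_intros continuous_on_UNIV_compose[OF assms(1)] continuous_on_UNIV_compose[OF assms(2)])

lemma continuous_on_conv:
  fixes u v :: "'a \<Rightarrow> complex"
  assumes "continuous_on UNIV u" "continuous_on UNIV v"
  shows "continuous_on UNIV (conv u v)"
  unfolding conv_def[abs_def] by (rule continuous_on_mean[OF continuous_on_conv_kernel[OF assms]])

lemma conv_commute:
  fixes u v :: "'a \<Rightarrow> complex"
  assumes "continuous_on UNIV u" "continuous_on UNIV v"
  shows "conv u v = conv v u"
proof
  show "conv u v x = conv v u x" for x
    using mean_reflect_translate[OF continuous_on_conv_integrand[OF assms, of x], of x]
    by (simp add: conv_def mult.commute)
qed

text \<open>
  Fubini for the kernel \<open>u (x - z) * v (z - y) * w y\<close>.
\<close>
lemma conv_assoc: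
  fixes u v w :: "'a \<Rightarrow> complex"
  assumes u: "continuous_on UNIV u" and v: "continuous_on UNIV v" and w: "continuous_on UNIV w"
  shows "conv (conv u v) w = conv u (conv v w)"
proof
  fix x
  have "conv (conv u v) w x = mean (\<lambda>y. mean (\<lambda>z. w y * (u (x - y - z) * v z)))"
  proof -
    have "conv u v (x - y) * w y = mean (\<lambda>z. w y * (u (x - y - z) * v z))" for y
      unfolding mean_cmult[OF continuous_on_conv_integrand[OF u v]] conv_def
      by (rule mult.commute)
    then show ?thesis unfolding conv_def[of "conv u v"] by presburger
  qed
  also have "\<dots> = mean (\<lambda>y. mean (\<lambda>z. u (x - z) * (v (z - y) * w y)))"
  proof -
    have "mean (\<lambda>z. w y * (u (x - y - z) * v z)) = mean (\<lambda>z. u (x - z) * (v (z - y) * w y))" for y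
    proof -
      have "continuous_on UNIV (\<lambda>z. w y * (u (x - y - z) * v z))"
        by (intro continuous_intros continuous_on_UNIV_compose[OF u] continuous_on_UNIV_compose[OF v])
      from mean_translate[OF this, of "- y"] show ?thesis
        by (simp add: algebra_simps)
    qed
    then show ?thesis by simp
  qed
  also have "\<dots> = mean (\<lambda>z. mean (\<lambda>y. u (x - z) * (v (z - y) * w y)))"
    by (rule mean_swap) (auto simp: case_prod_unfold intro!: continuous_intros
      continuous_on_UNIV_compose[OF u] continuous_on_UNIV_compose[OF v] continuous_on_UNIV_compose[OF w])
  also have "\<dots> = conv u (conv v w) x"
    by (simp add: conv_def mean_cmult[OF continuous_on_conv_integrand[OF v w]])
  finally show "conv (conv u v) w x = conv u (conv v w) x" .
qed

lemma conv_add_left: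
  fixes u v w :: "'a \<Rightarrow> complex"
  assumes "continuous_on UNIV u" "continuous_on UNIV v" "continuous_on UNIV w"
  shows "conv (\<lambda>x. u x + v x) w = (\<lambda>x. conv u w x + conv v w x)"
  by (rule ext) (simp add: conv_def ring_distribs
      mean_add[OF continuous_on_conv_integrand[OF assms(1,3)] continuous_on_conv_integrand[OF assms(2,3)]])

lemma conv_diff_left:
  fixes u v w :: "'a \<Rightarrow> complex"
  assumes "continuous_on UNIV u" "continuous_on UNIV v" "continuous_on UNIV w"
  shows "conv (\<lambda>x. u x - v x) w = (\<lambda>x. conv u w x - conv v w x)"
  by (rule ext) (simp add: conv_def ring_distribs
      mean_diff[OF continuous_on_conv_integrand[OF assms(1,3)] continuous_on_conv_integrand[OF assms(2,3)]])

lemma conv_cmult_left: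
  fixes u v :: "'a \<Rightarrow> complex"
  assumes "continuous_on UNIV u" "continuous_on UNIV v"
  shows "conv (\<lambda>x. c * u x) v = (\<lambda>x. c * conv u v x)"
  by (rule ext) (simp add: conv_def mult.assoc mean_cmult[OF continuous_on_conv_integrand[OF assms]])

lemma conv_add_right:
  fixes u v w :: "'a \<Rightarrow> complex"
  assumes "continuous_on UNIV u" "continuous_on UNIV v" "continuous_on UNIV w"
  shows "conv u (\<lambda>x. v x + w x) = (\<lambda>x. conv u v x + conv u w x)"
proof -
  have c: "continuous_on UNIV (\<lambda>x. v x + w x)" by (intro continuous_intros assms)
  show ?thesis
    unfolding conv_commute[OF assms(1) c] conv_commute[OF assms(1,2)] conv_commute[OF assms(1,3)]
    by (rule conv_add_left[OF assms(2,3,1)])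
qed

lemma conv_diff_right:
  fixes u v w :: "'a \<Rightarrow> complex"
  assumes "continuous_on UNIV u" "continuous_on UNIV v" "continuous_on UNIV w"
  shows "conv u (\<lambda>x. v x - w x) = (\<lambda>x. conv u v x - conv u w x)"
proof -
  have c: "continuous_on UNIV (\<lambda>x. v x - w x)" by (intro continuous_intros assms)
  show ?thesis
    unfolding conv_commute[OF assms(1) c] conv_commute[OF assms(1,2)] conv_commute[OF assms(1,3)]
    by (rule conv_diff_left[OF assms(2,3,1)])
qed

lemma conv_cmult_right:
  fixes u v :: "'a \<Rightarrow> complex"
  assumes "continuous_on UNIV u" "continuous_on UNIV v"
  shows "conv u (\<lambda>x. c * v x) = (\<lambda>x. c * conv u v x)"
proof -
  have c: "continuous_on UNIV (\<lambda>x. c * v x)" by (intro continuous_intros assms)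
  show ?thesis
    unfolding conv_commute[OF assms(1) c] conv_commute[OF assms]
    by (rule conv_cmult_left[OF assms(2,1)])
qed

lemma conv_translate_left:
  fixes u v :: "'a \<Rightarrow> complex"
  shows "conv (\<lambda>x. u (a + x)) v = (\<lambda>x. conv u v (a + x))"
  by (rule ext) (simp add: conv_def add_diff_eq)

lemma conv_zero_left [simp]: "conv (\<lambda>_. 0) (u :: 'a \<Rightarrow> complex) = (\<lambda>_. 0)"
  by (rule ext) (simp add: conv_def mean_const)

lemma conv_zero_right [simp]: "conv (u :: 'a \<Rightarrow> complex) (\<lambda>_. 0) = (\<lambda>_. 0)"
  by (rule ext) (simp add: conv_def mean_const)

lemma conv_one_left:
  "continuous_on UNIV u \<Longrightarrow> conv (\<lambda>_. 1) (u :: 'a \<Rightarrow> complex) = (\<lambda>_. mean u)"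
  by (rule ext) (simp add: conv_def)

lemma adj_conv:
  fixes u v :: "'a \<Rightarrow> complex"
  assumes "continuous_on UNIV u" "continuous_on UNIV v"
  shows "adj (conv u v) = conv (adj u) (adj v)"
proof
  fix x
  have c: "continuous_on UNIV (\<lambda>y. cnj (u (- x - y) * v y))"
    by (intro continuous_intros continuous_on_conv_integrand assms)
  have "adj (conv u v) x = mean (\<lambda>y. cnj (u (- x - y) * v y))"
    by (simp only: adj_def conv_def mean_cnj[OF continuous_on_conv_integrand[OF assms]])
  also have "\<dots> = mean (\<lambda>y. cnj (u (- x - - y) * v (- y)))"
    using mean_reflect[OF c] by simp
  also have "\<dots> = conv (adj u) (adj v) x"
    by (simp add: conv_def adj_def)
  finally show "adj (conv u v) x = conv (adj u) (adj v) x" .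
qed

lemma continuous_on_cmod_sq:
  fixes u :: "'a \<Rightarrow> complex"
  shows "continuous_on UNIV u \<Longrightarrow> continuous_on UNIV (\<lambda>x. (cmod (u x))\<^sup>2)"
  by (intro continuous_intros)

lemma of_real_sqnorm:
  fixes u :: "'a \<Rightarrow> complex"
  assumes "continuous_on UNIV u"
  shows "of_real (sqnorm u) = mean (\<lambda>x. of_real ((cmod (u x))\<^sup>2))"
  unfolding sqnorm_def using mean_of_real_Reals[OF continuous_on_cmod_sq[OF assms]] by simp

lemma conv_adj_self_at_0:
  fixes u :: "'a \<Rightarrow> complex"
  assumes "continuous_on UNIV u"
  shows "conv (adj u) u 0 = of_real (sqnorm u)"
  unfolding of_real_sqnorm[OF assms]
  by (simp add: conv_def adj_def complex_norm_square mult.commute[of "cnj z" for z] del: of_real_power)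

lemma sqnorm_pos:
  fixes u :: "'a \<Rightarrow> complex"
  assumes "continuous_on UNIV u" "u \<noteq> (\<lambda>_. 0)"
  shows "sqnorm u > 0"
proof -
  obtain x0 where "u x0 \<noteq> 0" using assms(2) by auto
  then show ?thesis
    unfolding sqnorm_def
    by (intro mean_pos[OF continuous_on_cmod_sq[OF assms(1)], of x0]) auto
qed

lemma sqnorm_zero [simp]: "sqnorm (\<lambda>_::'a. 0) = 0"
  by (simp add: sqnorm_def mean_const)

lemma sqnorm_nonneg:
  fixes u :: "'a \<Rightarrow> complex"
  shows "continuous_on UNIV u \<Longrightarrow> sqnorm u \<ge> 0"
  using sqnorm_pos[of u] by (cases "u = (\<lambda>_. 0)") auto

lemma sqnorm_le:
  fixes u :: "'a \<Rightarrow> complex"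
  assumes "continuous_on UNIV u" "\<And>x. (cmod (u x))\<^sup>2 \<le> C"
  shows "sqnorm u \<le> C"
proof -
  have "norm (mean (\<lambda>x. complex_of_real ((cmod (u x))\<^sup>2))) \<le> C"
    using assms(2) by (intro norm_mean_le_const continuous_intros assms(1)) (simp del: of_real_power)
  then show ?thesis unfolding sqnorm_def using complex_Re_le_cmod order_trans by blast
qed

text \<open>
  With \<open>t\<close> chosen to balance the two terms, the inequality is the mean of
  \<open>\<bar>u v\<bar> \<le> t \<bar>u\<bar>\<^sup>2 / 2 + \<bar>v\<bar>\<^sup>2 / (2 t)\<close>.
\<close>
lemma mean_Cauchy_Schwarz:
  fixes u v :: "'a \<Rightarrow> complex"
  assumes u: "continuous_on UNIV u" and v: "continuous_on UNIV v"
  shows "(norm (mean (\<lambda>x. u x * v x)))\<^sup>2 \<le> sqnorm u * sqnorm v"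
proof (cases "u = (\<lambda>_. 0) \<or> v = (\<lambda>_. 0)")
  case True
  then show ?thesis by (auto simp: mean_const)
next
  case False
  then have pos: "sqnorm u > 0" "sqnorm v > 0" using sqnorm_pos u v by auto
  define t where "t = sqrt (sqnorm v / sqnorm u)"
  have t: "t > 0" "t\<^sup>2 = sqnorm v / sqnorm u" using pos by (auto simp: t_def)
  have tv: "sqnorm v = t * (t * sqnorm u)"
  proof -
    have "t\<^sup>2 * sqnorm u = sqnorm v" using t(2) pos by simp
    then show ?thesis by (simp add: power2_eq_square mult.assoc)
  qed
  let ?r = "\<lambda>x. (t / 2) * (cmod (u x))\<^sup>2 + (1 / (2 * t)) * (cmod (v x))\<^sup>2"
  have cr: "continuous_on UNIV ?r" by (intro continuous_intros u v)
  have le: "norm (u x * v x) \<le> ?r x" for x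
  proof -
    have "0 \<le> (t * cmod (u x) - cmod (v x))\<^sup>2 / (2 * t)" using t by simp
    also have "\<dots> = ?r x - cmod (u x) * cmod (v x)"
      using t(1) by (simp add: power2_eq_square field_simps)
    finally show ?thesis by (simp add: norm_mult)
  qed
  have cu: "continuous_on UNIV (\<lambda>x. complex_of_real ((cmod (u x))\<^sup>2))"
    and cv: "continuous_on UNIV (\<lambda>x. complex_of_real ((cmod (v x))\<^sup>2))" by (intro continuous_intros u v)+
  have "mean (\<lambda>x. complex_of_real (?r x)) = mean (\<lambda>x. of_real (t / 2) * complex_of_real ((cmod (u x))\<^sup>2) +
      of_real (1 / (2 * t)) * complex_of_real ((cmod (v x))\<^sup>2))" by simp
  also have "\<dots> = of_real (t / 2) * of_real (sqnorm u) + of_real (1 / (2 * t)) * of_real (sqnorm v)"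
    unfolding of_real_sqnorm[OF u] of_real_sqnorm[OF v]
      mean_cmult[OF cu, symmetric] mean_cmult[OF cv, symmetric]
    by (intro mean_add continuous_intros u v)
  finally have "Re (mean (\<lambda>x. complex_of_real (?r x))) = t / 2 * sqnorm u + 1 / (2 * t) * sqnorm v"
    by (simp del: of_real_mult of_real_divide add: flip: of_real_mult of_real_add)
  then have "norm (mean (\<lambda>x. u x * v x)) \<le> t / 2 * sqnorm u + 1 / (2 * t) * sqnorm v"
    using norm_mean_le[OF _ cr le] by (simp add: u v continuous_on_mult)
  also have "\<dots> = t * sqnorm u"
    using t(1) tv by simp
  finally have "(norm (mean (\<lambda>x. u x * v x)))\<^sup>2 \<le> (t * sqnorm u)\<^sup>2" by (simp add: power_mono)
  also have "\<dots> = sqnorm u * sqnorm v" using tv by (simp add: power2_eq_square)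
  finally show ?thesis .
qed

lemma conv_Cauchy_Schwarz:
  fixes u v :: "'a \<Rightarrow> complex"
  assumes u: "continuous_on UNIV u" and v: "continuous_on UNIV v"
  shows "(norm (conv u v x))\<^sup>2 \<le> sqnorm u * sqnorm v"
proof -
  have "continuous_on UNIV (\<lambda>y. u (x - y))" by (intro continuous_intros continuous_on_UNIV_compose[OF u])
  from mean_Cauchy_Schwarz[OF this v]
  have "(norm (conv u v x))\<^sup>2 \<le> sqnorm (\<lambda>y. u (x - y)) * sqnorm v" unfolding conv_def .
  moreover have "continuous_on UNIV (\<lambda>y. complex_of_real ((cmod (u y))\<^sup>2))" by (intro continuous_intros u)
  from mean_reflect_translate[OF this, of x] have "sqnorm (\<lambda>y. u (x - y)) = sqnorm u"
    by (simp add: sqnorm_def)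
  ultimately show ?thesis by simp
qed

lemma conv_tendsto:
  fixes u :: "'a \<Rightarrow> complex" and P :: "nat \<Rightarrow> 'a \<Rightarrow> complex"
  assumes u: "continuous_on UNIV u" and P: "\<And>n. continuous_on UNIV (P n)" and p: "continuous_on UNIV p"
    and lim: "uniform_limit UNIV P p sequentially"
  shows "(\<lambda>n. conv u (P n) x) \<longlonglongrightarrow> conv u p x"
proof (rule tendstoI)
  fix e :: real assume "e > 0"
  obtain B where B: "\<And>x. norm (u x) \<le> B" using compact_bounded_continuous[OF compact_UNIV u] by blast
  have "B \<ge> 0" using B[of 0] norm_ge_zero order_trans by blast
  define \<delta> where "\<delta> = e / (2 * (B + 1))"
  have "\<delta> > 0" using \<open>B \<ge> 0\<close> \<open>e > 0\<close> by (simp add: \<delta>_def)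
  then have "eventually (\<lambda>n. \<forall>x\<in>UNIV. dist (P n x) (p x) < \<delta>) sequentially"
    using lim by (simp add: uniform_limit_iff)
  then show "eventually (\<lambda>n. dist (conv u (P n) x) (conv u p x) < e) sequentially"
  proof eventually_elim
    case (elim n)
    have "norm (conv u (\<lambda>x. P n x - p x) x) \<le> (B + 1) * \<delta>"
      unfolding conv_def
    proof (rule norm_mean_le_const)
      show "continuous_on UNIV (\<lambda>y. u (x - y) * (P n y - p y))"
        by (intro continuous_intros continuous_on_UNIV_compose[OF u] P p)
      show "norm (u (x - y) * (P n y - p y)) \<le> (B + 1) * \<delta>" for y
        unfolding norm_mult
        using B[of "x - y"] elim \<open>B \<ge> 0\<close> by (intro mult_mono) (auto simp: dist_norm less_imp_le)
    qed
    also have "(B + 1) * \<delta> = e / 2" using \<open>B \<ge> 0\<close> by (simp add: \<delta>_def field_simps)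
    also have "\<dots> < e" using \<open>e > 0\<close> by simp
    finally show ?case by (simp add: dist_norm conv_diff_right u P p)
  qed
qed

section \<open>Spectral projections by the power method\<close>

lemma continuous_on_cpow:
  fixes k :: "'a \<Rightarrow> complex"
  shows "continuous_on UNIV k \<Longrightarrow> continuous_on UNIV (cpow k n)"
  by (induction n) (auto intro: continuous_on_conv)

lemma adj_cpow:
  fixes k :: "'a \<Rightarrow> complex"
  shows "continuous_on UNIV k \<Longrightarrow> adj k = k \<Longrightarrow> adj (cpow k n) = cpow k n"
  by (induction n) (auto simp: adj_conv continuous_on_cpow)

lemma conv_cpow:
  fixes k :: "'a \<Rightarrow> complex"
  assumes "continuous_on UNIV k"
  shows "conv (cpow k m) (cpow k n) = cpow k (m + n + 1)"
  by (induction m) (auto simp: conv_assoc continuous_on_cpow assms)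

text \<open>
  If \<open>cpow k n\<close> is nonzero, so is its square \<open>cpow k (2 n + 1)\<close>, whose value at \<open>0\<close> is a squared norm; and
  that power contains \<open>cpow k (n + 1)\<close> as a factor.
\<close>
lemma cpow_nonzero:
  fixes k :: "'a \<Rightarrow> complex"
  assumes k: "continuous_on UNIV k" "adj k = k" "k \<noteq> (\<lambda>_. 0)"
  shows "cpow k n \<noteq> (\<lambda>_. 0)"
proof (induction n)
  case (Suc n)
  have "cpow k (n + n + 1) 0 = of_real (sqnorm (cpow k n))"
    using conv_adj_self_at_0[OF continuous_on_cpow[OF k(1)], of n] by (simp add: adj_cpow k conv_cpow)
  then have nz: "cpow k (n + n + 1) \<noteq> (\<lambda>_. 0)"
    using sqnorm_pos[OF continuous_on_cpow[OF k(1)] Suc] by auto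
  have "cpow k (Suc n + j) = (\<lambda>_. 0)" if "cpow k (Suc n) = (\<lambda>_. 0)" for j
    using that by (induction j) auto
  from this[of n] nz show ?case by auto
qed (use k in auto)

lemma sqnorm_self_adjoint:
  fixes u :: "'a \<Rightarrow> complex"
  assumes "continuous_on UNIV u" "adj u = u"
  shows "conv u u 0 = of_real (sqnorm u)"
  using conv_adj_self_at_0[OF assms(1)] assms(2) by simp

lemma cpow_sqnorm:
  fixes k :: "'a \<Rightarrow> complex"
  assumes "continuous_on UNIV k" "adj k = k"
  shows "cpow k (2 * n + 1) 0 = of_real (sqnorm (cpow k n))"
  using sqnorm_self_adjoint[OF continuous_on_cpow[OF assms(1)] adj_cpow[OF assms], of n]
  by (simp add: conv_cpow[OF assms(1)] mult_2)

text \<open>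
  As \<open>k\<close> is self-adjoint, squared norms of powers are values of higher powers at \<open>0\<close>. Log-convexity and
  submultiplicativity are then two instances of the Cauchy--Schwarz inequality for convolutions.
\<close>
lemma cpow_sqnorm_growth:
  fixes k :: "'a \<Rightarrow> complex"
  assumes k: "continuous_on UNIV k" "adj k = k" "k \<noteq> (\<lambda>_. 0)"
  obtains \<rho> L where "\<rho> > 0" "L \<ge> 1" "(\<lambda>n. sqnorm (cpow k n) / \<rho> ^ (n + 1)) \<longlonglongrightarrow> L"
proof (rule logconvex_submultiplicative_growth)
  note c = continuous_on_cpow[OF k(1)]
  show pos: "sqnorm (cpow k n) > 0" for n
    by (rule sqnorm_pos[OF c cpow_nonzero[OF k]])
  show "(sqnorm (cpow k (n + 1)))\<^sup>2 \<le> sqnorm (cpow k n) * sqnorm (cpow k (n + 2))" for n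
  proof -
    have "conv (cpow k n) (cpow k (n + 2)) = cpow k (2 * (n + 1) + 1)"
      unfolding conv_cpow[OF k(1)] by (simp add: mult_2)
    then have "conv (cpow k n) (cpow k (n + 2)) 0 = of_real (sqnorm (cpow k (n + 1)))"
      using cpow_sqnorm[OF k(1,2), of "n + 1"] by simp
    with conv_Cauchy_Schwarz[OF c c, of n "n + 2" 0] show ?thesis by simp
  qed
  show "sqnorm (cpow k (m + n + 1)) \<le> sqnorm (cpow k m) * sqnorm (cpow k n)" for m n
    unfolding conv_cpow[OF k(1), symmetric]
    by (intro sqnorm_le conv_Cauchy_Schwarz continuous_on_conv c)
qed (rule that)

text \<open>
  The power method. Let \<open>b n\<close> be the normalized squared norms of the powers of \<open>k\<close>, which converge to a
  positive limit. The normalized even powers \<open>P n\<close> satisfy \<open>P m * P n = P (m + n + 1)\<close>, so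
  the squared distance of \<open>P m\<close> and \<open>P n\<close> is \<open>b (2 m + 1) - 2 b (m + n + 1) + b (2 n + 1)\<close>, which tends to \<open>0\<close>.
  One further convolution with \<open>P 0\<close> turns this \<open>L\<^sup>2\<close> convergence into uniform convergence.
  In spectral terms \<open>\<rho>\<close> is the largest eigenvalue of the positive operator of convolution with \<open>k * k\<close>,
  and \<open>p\<close> is the kernel of the projection onto its eigenspace.
\<close>
lemma top_projection:
  fixes k :: "'a \<Rightarrow> complex"
  assumes k: "continuous_on UNIV k" "adj k = k" "k \<noteq> (\<lambda>_. 0)"
  obtains p \<rho> where "projection p" "\<rho> > 0" "conv (conv k k) p = (\<lambda>x. of_real \<rho> * p x)"
proof -
  obtain \<rho> L where \<rho>: "\<rho> > 0" "L \<ge> 1" and L: "(\<lambda>n. sqnorm (cpow k n) / \<rho> ^ (n + 1)) \<longlonglongrightarrow> L"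
    using cpow_sqnorm_growth[OF k] by blast
  define b where "b n = sqnorm (cpow k n) / \<rho> ^ (n + 1)" for n
  define P where "P n = (\<lambda>x. of_real (1 / \<rho> ^ (n + 1)) * cpow k (2 * n + 1) x)" for n
  note ck = continuous_on_cpow[OF k(1)]
  have cP: "continuous_on UNIV (P n)" for n unfolding P_def by (intro continuous_intros ck)
  have adjP: "adj (P n) = P n" for n
    using fun_cong[OF adj_cpow[OF k(1,2), of "2 * n + 1"]]
    by (intro ext) (simp add: P_def adj_def)
  have PP: "conv (P m) (P n) = P (m + n + 1)" for m n
  proof -
    have "conv (P m) (P n) = (\<lambda>x. of_real (1 / \<rho> ^ (m + 1)) * (of_real (1 / \<rho> ^ (n + 1)) *
        conv (cpow k (2 * m + 1)) (cpow k (2 * n + 1)) x))"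
      unfolding P_def
      by (simp only: conv_cmult_left[OF ck] conv_cmult_right[OF ck ck]
        continuous_on_mult_left[OF ck])
    also have "conv (cpow k (2 * m + 1)) (cpow k (2 * n + 1)) = cpow k (2 * (m + n + 1) + 1)"
      unfolding conv_cpow[OF k(1)] by (simp add: algebra_simps)
    finally show ?thesis by (simp add: P_def power_add mult_ac)
  qed
  have P0: "P n 0 = of_real (b n)" for n
    using cpow_sqnorm[OF k(1,2), of n] by (simp add: P_def b_def)
  have dist: "sqnorm (\<lambda>x. P m x - P n x) = b (2 * m + 1) - 2 * b (m + n + 1) + b (2 * n + 1)" for m n
  proof -
    let ?Q = "\<lambda>x. P m x - P n x"
    have cQ: "continuous_on UNIV ?Q" by (intro continuous_intros cP)
    have "adj ?Q = ?Q" using fun_cong[OF adjP[of m]] fun_cong[OF adjP[of n]]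
      by (intro ext) (simp add: adj_def)
    then have "of_real (sqnorm ?Q) = conv ?Q ?Q 0" using sqnorm_self_adjoint[OF cQ] by simp
    also have "\<dots> = P (m + m + 1) 0 - P (m + n + 1) 0 - (P (n + m + 1) 0 - P (n + n + 1) 0)"
      by (simp only: conv_diff_left[OF cP cP cQ] conv_diff_right[OF cP cP cP] PP)
    also have "\<dots> = of_real (b (2 * m + 1) - 2 * b (m + n + 1) + b (2 * n + 1))"
      unfolding P0 mult_2 add.commute[of n m] by simp
    finally show ?thesis by (simp only: of_real_eq_iff)
  qed
  have "uniformly_Cauchy_on UNIV (\<lambda>n. P (n + 1))"
  proof (rule uniformly_Cauchy_onI)
    fix e :: real assume "e > 0"
    define s where "s = sqnorm (P 0)"
    have "s \<ge> 0" unfolding s_def by (rule sqnorm_nonneg[OF cP])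
    \<comment> \<open>The squared distance of \<open>P m\<close> and \<open>P n\<close> is at most \<open>4 \<delta>\<close>; the \<open>s + 1\<close> covers the case \<open>s = 0\<close>.\<close>
    define \<delta> where "\<delta> = e\<^sup>2 / (4 * (s + 1))"
    have "\<delta> > 0" using \<open>e > 0\<close> \<open>s \<ge> 0\<close> by (simp add: \<delta>_def)
    then obtain N where N: "\<And>n. n \<ge> N \<Longrightarrow> \<bar>b n - L\<bar> < \<delta>"
      using L[folded b_def] unfolding LIMSEQ_iff by auto
    have "dist (P (m + 1) x) (P (n + 1) x) < e" if mn: "m \<ge> N" "n \<ge> N" for m n x
    proof -
      let ?Q = "\<lambda>x. P m x - P n x"
      have cQ: "continuous_on UNIV ?Q" by (intro continuous_intros cP)
      have "conv (P 0) ?Q = (\<lambda>x. P (m + 1) x - P (n + 1) x)"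
        by (simp add: conv_diff_right[OF cP cP cP] PP)
      then have "(cmod (P (m + 1) x - P (n + 1) x))\<^sup>2 \<le> s * sqnorm ?Q"
        using conv_Cauchy_Schwarz[OF cP cQ, of 0 x] by (simp add: s_def)
      also have "\<dots> \<le> s * (4 * \<delta>)"
        using N[of "2 * m + 1"] N[of "m + n + 1"] N[of "2 * n + 1"] mn \<open>s \<ge> 0\<close>
        unfolding dist by (intro mult_left_mono) auto
      also have "\<dots> < (s + 1) * (4 * \<delta>)" using \<open>\<delta> > 0\<close> by simp
      also have "\<dots> = e\<^sup>2" using \<open>s \<ge> 0\<close> by (simp add: \<delta>_def field_simps)
      finally show ?thesis using \<open>e > 0\<close> by (simp add: dist_norm power2_less_imp_less)
    qed
    then show "\<exists>M. \<forall>x\<in>UNIV. \<forall>m\<ge>M. \<forall>n\<ge>M. dist (P (m + 1) x) (P (n + 1) x) < e" by blast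
  qed
  then obtain p where lim: "uniform_limit UNIV (\<lambda>n. P (n + 1)) p sequentially"
    using Cauchy_uniformly_convergent unfolding uniformly_convergent_on_def by blast
  have cp: "continuous_on UNIV p"
    by (rule uniform_limit_theorem[OF _ lim]) (auto intro: always_eventually cP)
  have plim: "(\<lambda>n. P (n + 1) x) \<longlonglongrightarrow> p x" for x
    by (rule tendsto_uniform_limitI[OF lim]) simp
  have "adj p = p"
  proof
    fix x
    have "(\<lambda>n. adj (P (n + 1)) x) \<longlonglongrightarrow> adj p x"
      unfolding adj_def by (intro tendsto_cnj plim)
    then show "adj p x = p x" unfolding adjP using LIMSEQ_unique plim by blast
  qed
  have Pp: "conv (P m) p = p" for m
  proof
    fix x
    have "(\<lambda>n. conv (P m) (P (n + 1)) x) \<longlonglongrightarrow> conv (P m) p x"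
      by (rule conv_tendsto[OF cP cP cp lim])
    moreover have "(\<lambda>n. conv (P m) (P (n + 1)) x) \<longlonglongrightarrow> p x"
      unfolding PP using LIMSEQ_ignore_initial_segment[OF plim[of x], of "m + 1"] by (simp add: add_ac)
    ultimately show "conv (P m) p x = p x" by (rule LIMSEQ_unique)
  qed
  have "conv p p = p"
  proof
    fix x
    have "(\<lambda>n. conv p (P (n + 1)) x) \<longlonglongrightarrow> conv p p x"
      by (rule conv_tendsto[OF cp cP cp lim])
    then have "(\<lambda>n::nat. p x) \<longlonglongrightarrow> conv p p x"
      unfolding conv_commute[OF cp cP] Pp .
    then show "conv p p x = p x" by (simp add: LIMSEQ_const_iff)
  qed
  moreover have "p \<noteq> (\<lambda>_. 0)"
  proof -
    have "(\<lambda>n. P (n + 1) 0) \<longlonglongrightarrow> of_real L"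
      unfolding P0 using LIMSEQ_ignore_initial_segment[OF L[folded b_def], of 1] by (intro tendsto_of_real)
    then have "p 0 = of_real L" using LIMSEQ_unique plim by blast
    then show ?thesis using \<rho>(2) by (auto dest: fun_cong[where x = 0])
  qed
  ultimately have "projection p" using cp \<open>adj p = p\<close> by (simp add: projection_def)
  moreover have "conv (conv k k) p = (\<lambda>x. of_real \<rho> * p x)"
  proof -
    have "conv k k = (\<lambda>x. of_real \<rho> * P 0 x)" using \<rho>(1) by (simp add: P_def)
    then show ?thesis by (simp add: conv_cmult_left[OF cP cp] Pp)
  qed
  ultimately show ?thesis using that \<rho>(1) by blast
qed

text \<open>
  By Cauchy--Schwarz \<open>p = p * p\<close> is bounded by \<open>sqnorm p\<close>, so that \<open>sqnorm p \<le> (sqnorm p)\<^sup>2\<close>.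
\<close>
lemma projection_at_0:
  fixes p :: "'a \<Rightarrow> complex"
  assumes p: "projection p"
  shows "p 0 = of_real (sqnorm p)" "sqnorm p \<ge> 1"
proof -
  have c: "continuous_on UNIV p" and a: "adj p = p" and i: "conv p p = p" and nz: "p \<noteq> (\<lambda>_. 0)"
    using p by (auto simp: projection_def)
  show "p 0 = of_real (sqnorm p)" using sqnorm_self_adjoint[OF c a] by (simp add: i)
  have "(cmod (p x))\<^sup>2 \<le> sqnorm p * sqnorm p" for x
    using conv_Cauchy_Schwarz[OF c c, of x] by (simp add: i)
  then have "sqnorm p \<le> sqnorm p * sqnorm p" by (rule sqnorm_le[OF c])
  then show "sqnorm p \<ge> 1" using sqnorm_pos[OF c nz] by simp
qed

section \<open>Characters and invariant functions\<close>

text \<open>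
  Inside the ideal of \<open>p\<close> one of \<open>q\<close> and \<open>q + p\<close> has a square that is not a multiple of \<open>p\<close>; otherwise
  \<open>2 q = (q + p)\<^sup>2 - q\<^sup>2 - p\<close> would be one. The top projection \<open>p'\<close> of such an element lies below \<open>p\<close> and
  differs from it, so that \<open>p - p'\<close> is again a projection, with squared norm at least \<open>1\<close>.
\<close>
lemma projection_split:
  fixes p q :: "'a \<Rightarrow> complex"
  assumes p: "projection p" and q: "continuous_on UNIV q" "adj q = q" "conv p q = q"
    and nm: "\<nexists>c. q = (\<lambda>x. c * p x)"
  obtains p' where "projection p'" "conv p p' = p'" "sqnorm p' \<le> sqnorm p - 1"
proof -
  have cp: "continuous_on UNIV p" and ap: "adj p = p" and pp: "conv p p = p"
    using p by (auto simp: projection_def)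
  note comm = conv_commute
  obtain k where k: "continuous_on UNIV k" "adj k = k" "conv p k = k" "\<nexists>c. conv k k = (\<lambda>x. c * p x)"
  proof (cases "\<exists>c. conv q q = (\<lambda>x. c * p x)")
    case False
    then show ?thesis using that q by blast
  next
    case True
    then obtain c where c: "conv q q = (\<lambda>x. c * p x)" by blast
    let ?k = "\<lambda>x. q x + p x"
    have ck: "continuous_on UNIV ?k" by (intro continuous_intros q cp)
    have "adj ?k = ?k" using fun_cong[OF q(2)] fun_cong[OF ap] by (intro ext) (simp add: adj_def)
    moreover have "conv p ?k = ?k" by (simp add: conv_add_right[OF cp q(1) cp] q pp)
    moreover have "\<nexists>d. conv ?k ?k = (\<lambda>x. d * p x)"
    proof
      assume "\<exists>d. conv ?k ?k = (\<lambda>x. d * p x)"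
      then obtain d where d: "conv ?k ?k = (\<lambda>x. d * p x)" by blast
      have "conv ?k ?k = (\<lambda>x. c * p x + q x + (q x + p x))"
        by (simp add: conv_add_left[OF q(1) cp ck] conv_add_right[OF q(1) q(1) cp]
          conv_add_right[OF cp q(1) cp] q pp comm[OF q(1) cp] c)
      then have "d * p x = c * p x + q x + (q x + p x)" for x unfolding d by (rule fun_cong)
      then have "2 * q x = (d - c - 1) * p x" for x by (simp add: algebra_simps)
      then have "q = (\<lambda>x. ((d - c - 1) / 2) * p x)" by (intro ext) (simp add: field_simps)
      then show False using nm by blast
    qed
    ultimately show ?thesis using that ck by blast
  qed
  have "k \<noteq> (\<lambda>_. 0)"
  proof
    assume "k = (\<lambda>_. 0)"
    then have "conv k k = (\<lambda>x. 0 * p x)" by (simp add: conv_zero_left)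
    then show False using k(4) by blast
  qed
  then obtain p' \<rho> where p': "projection p'" and \<rho>: "\<rho> > 0" "conv (conv k k) p' = (\<lambda>x. of_real \<rho> * p' x)"
    using top_projection[OF k(1,2)] by blast
  have cp': "continuous_on UNIV p'" and ap': "adj p' = p'" and pp': "conv p' p' = p'"
    using p' by (auto simp: projection_def)
  have ckk: "continuous_on UNIV (conv k k)" by (rule continuous_on_conv[OF k(1,1)])
  \<comment> \<open>\<open>p'\<close> is a multiple of \<open>k * k * p'\<close>, and \<open>p\<close> acts as the identity on \<open>k\<close>.\<close>
  have "conv p (\<lambda>x. of_real \<rho> * p' x) = (\<lambda>x. of_real \<rho> * p' x)"
    unfolding \<rho>(2)[symmetric] conv_assoc[OF cp ckk cp', symmetric]
      conv_assoc[OF cp k(1,1), symmetric] k(3) ..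
  then have below: "conv p p' = p'"
    using \<rho>(1) by (auto simp: conv_cmult_right[OF cp cp'] fun_eq_iff)
  have "p' \<noteq> p"
  proof
    assume "p' = p"
    have "conv (conv k k) p = conv k k"
      unfolding comm[OF ckk cp] conv_assoc[OF cp k(1,1), symmetric] k(3) ..
    with \<rho>(2) \<open>p' = p\<close> k(4) show False by metis
  qed
  let ?d = "\<lambda>x. p x - p' x"
  have cd: "continuous_on UNIV ?d" by (intro continuous_intros cp cp')
  have "adj ?d = ?d" using fun_cong[OF ap] fun_cong[OF ap'] by (intro ext) (simp add: adj_def)
  moreover have "conv ?d ?d = ?d"
    by (simp add: conv_diff_left[OF cp cp' cd] conv_diff_right[OF cp cp cp']
        conv_diff_right[OF cp' cp cp'] pp pp' below comm[OF cp' cp])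
  moreover have "?d \<noteq> (\<lambda>_. 0)"
  proof
    assume "?d = (\<lambda>_. 0)"
    then have "p x - p' x = 0" for x by (rule fun_cong)
    then show False using \<open>p' \<noteq> p\<close> by auto
  qed
  ultimately have "projection ?d" using cd by (simp add: projection_def)
  then have "complex_of_real (sqnorm ?d) = of_real (sqnorm p - sqnorm p')" "sqnorm ?d \<ge> 1"
    using projection_at_0[of ?d] projection_at_0(1)[OF p] projection_at_0(1)[OF p']
    by auto
  then have "sqnorm p' \<le> sqnorm p - 1" unfolding of_real_eq_iff by linarith
  then show ?thesis using that p' below by blast
qed

text \<open>
  If translation by \<open>a\<close> multiplies \<open>p\<close> by a scalar, then evaluating at \<open>0\<close> shows that the scalar is \<open>p a / p 0\<close>,
  which makes \<open>p / p 0\<close> multiplicative. It has modulus \<open>1\<close> because \<open>p (- x)\<close> is the conjugate of \<open>p x\<close>.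
\<close>
lemma projection_with_scalar_translations:
  fixes p :: "'a \<Rightarrow> complex"
  assumes p: "projection p" and tr: "\<And>a. \<exists>c. (\<lambda>x. p (a + x)) = (\<lambda>x. c * p x)"
  shows "topological_character (\<lambda>x. p x / p 0)"
proof -
  have cp: "continuous_on UNIV p" and ap: "adj p = p"
    using p by (auto simp: projection_def)
  obtain s where s: "p 0 = of_real s" "s \<ge> 1" using projection_at_0[OF p] by blast
  have mult: "p (a + x) * p 0 = p a * p x" for a x
  proof -
    obtain c where c: "\<And>x. p (a + x) = c * p x" using tr[of a] by (auto simp: fun_eq_iff)
    show ?thesis using c[of x] c[of 0] by simp
  qed
  have "norm (p x / p 0) = 1" for x
  proof -
    have "p x * cnj (p x) = of_real (s * s)"
      using mult[of x "- x"] fun_cong[OF ap, of "- x"] s by (simp add: adj_def)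
    then have "complex_of_real ((norm (p x))\<^sup>2) = of_real (s\<^sup>2)"
      by (simp only: complex_norm_square power2_eq_square[of s])
    then have "norm (p x) = s" using s(2) by (simp only: of_real_eq_iff) (simp add: power2_eq_iff_nonneg)
    then show ?thesis using s by (simp add: norm_divide)
  qed
  moreover have "p (x + y) / p 0 = p x / p 0 * (p y / p 0)" for x y
    using mult[of x y] s by (simp add: field_simps)
  moreover have "continuous_on UNIV (\<lambda>x. p x / p 0)" using s by (intro continuous_intros cp) auto
  ultimately show ?thesis by (simp add: topological_character_def)
qed

text \<open>
  The translate of \<open>p\<close> by \<open>a\<close> need not be self-adjoint, but it is a combination of two self-adjoint elements, its
  real and imaginary parts in the convolution algebra; one of these is not a multiple of \<open>p\<close>.
\<close>
lemma projection_translations_split: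
  fixes p :: "'a \<Rightarrow> complex"
  assumes p: "projection p" and nt: "\<nexists>c. (\<lambda>x. p (a + x)) = (\<lambda>x. c * p x)"
  obtains p' where "projection p'" "conv p p' = p'" "sqnorm p' \<le> sqnorm p - 1"
proof -
  have cp: "continuous_on UNIV p" and ap: "adj p = p" and pp: "conv p p = p"
    using p by (auto simp: projection_def)
  have ap': "cnj (p (- x)) = p x" for x using fun_cong[OF ap] by (simp add: adj_def)
  have ct: "continuous_on UNIV (\<lambda>x. p (b + x))" for b
    by (intro continuous_intros continuous_on_UNIV_compose[OF cp])
  have pt: "conv p (\<lambda>x. p (b + x)) = (\<lambda>x. p (b + x))" for b
    unfolding conv_commute[OF cp ct] conv_translate_left pp ..
  let ?q1 = "\<lambda>x. p (a + x) + p (- a + x)"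
  let ?q2 = "\<lambda>x. \<i> * (p (a + x) - p (- a + x))"
  have c: "continuous_on UNIV ?q1" "continuous_on UNIV ?q2"
    by (intro continuous_intros continuous_on_UNIV_compose[OF cp])+
  have adj: "adj ?q1 = ?q1" "adj ?q2 = ?q2"
    using ap'[of "a + x" for x] ap'[of "- a + x" for x]
    by (auto simp: adj_def fun_eq_iff algebra_simps)
  have "conv p ?q1 = ?q1" by (simp only: conv_add_right[OF cp ct ct] pt)
  moreover have "conv p ?q2 = ?q2"
    by (simp only: conv_cmult_right[OF cp continuous_on_diff[OF ct ct]]
       conv_diff_right[OF cp ct ct] pt)
  moreover have "(\<nexists>c. ?q1 = (\<lambda>x. c * p x)) \<or> (\<nexists>c. ?q2 = (\<lambda>x. c * p x))"
  proof (rule ccontr)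
    assume "\<not> ?thesis"
    then obtain c d where "?q1 = (\<lambda>x. c * p x)" "?q2 = (\<lambda>x. d * p x)" by blast
    then have cd: "p (a + x) + p (- a + x) = c * p x" "\<i> * (p (a + x) - p (- a + x)) = d * p x" for x
      by (auto dest: fun_cong[where x = x])
    have "2 * p (a + x) = (c - \<i> * d) * p x" for x
    proof -
      have "(c - \<i> * d) * p x = c * p x - \<i> * (d * p x)" by (simp add: algebra_simps)
      also have "\<dots> = 2 * p (a + x)" unfolding cd[symmetric] by (simp add: algebra_simps)
      finally show ?thesis ..
    qed
    then have "(\<lambda>x. p (a + x)) = (\<lambda>x. ((c - \<i> * d) / 2) * p x)" by (intro ext) (simp add: field_simps)
    then show False using nt by blast
  qed
  ultimately show ?thesis
    using projection_split[OF p c(1) adj(1)] projection_split[OF p c(2) adj(2)] that by blast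
qed

text \<open>
  Each splitting lowers the squared norm by at least \<open>1\<close>, while it stays at least \<open>1\<close>; so the descent ends
  at a projection whose translates are all multiples of it.
\<close>
lemma projection_dominates_character:
  fixes p :: "'a \<Rightarrow> complex"
  assumes "projection p"
  obtains \<chi> where "topological_character \<chi>" "conv p \<chi> = \<chi>"
proof -
  have "\<exists>\<chi>. topological_character \<chi> \<and> conv p \<chi> = \<chi>" if "projection p" "sqnorm p < real n"
    for n and p :: "'a \<Rightarrow> complex"
    using that
  proof (induction n arbitrary: p)
    case 0
    then show ?case using projection_at_0(2)[of p] by simp
  next
    case (Suc n)
    have cp: "continuous_on UNIV p" and pp: "conv p p = p"
      using Suc.prems by (auto simp: projection_def)
    show ?case
    proof (cases "\<forall>a. \<exists>c. (\<lambda>x. p (a + x)) = (\<lambda>x. c * p x)")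
      case True
      have "conv p (\<lambda>x. inverse (p 0) * p x) = (\<lambda>x. inverse (p 0) * p x)"
        by (simp add: conv_cmult_right[OF cp cp] pp)
      with projection_with_scalar_translations[OF Suc.prems(1)] True show ?thesis
        by (intro exI[of _ "\<lambda>x. p x / p 0"]) (auto simp: divide_inverse mult.commute)
    next
      case False
      then obtain p' where p': "projection p'" "conv p p' = p'" "sqnorm p' \<le> sqnorm p - 1"
        using projection_translations_split[OF Suc.prems(1)] by blast
      then obtain \<chi> where \<chi>: "topological_character \<chi>" "conv p' \<chi> = \<chi>"
        using Suc.IH[of p'] Suc.prems(2) by auto
      have c: "continuous_on UNIV p'" "continuous_on UNIV \<chi>"
        using p' \<chi> by (auto simp: projection_def topological_character_def)
      have "conv p \<chi> = \<chi>"
        using conv_assoc[OF cp c] by (simp add: \<chi> p')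
      with \<chi>(1) show ?thesis by blast
    qed
  qed
  moreover obtain n where "sqnorm p < real n" using reals_Archimedean2 by blast
  ultimately show ?thesis using assms that by blast
qed

text \<open>
  A nonzero invariant \<open>f0\<close> of mean \<open>0\<close> gives \<open>k = f0 * f0\<^sup>*\<close>, and then a character \<open>\<chi>\<close> with
  \<open>k * k * \<chi> = \<rho> \<chi>\<close>. Both properties of \<open>f0\<close> pass to \<open>k\<close> and thus to \<open>\<chi>\<close>: it is invariant
  under \<open>g\<close>, and it is not the unity character, which is annihilated by \<open>k\<close>.
\<close>
lemma invariant_continuous_is_constant:
  fixes f :: "'a \<Rightarrow> complex"
  assumes chars: "\<forall>\<chi> :: 'a \<Rightarrow> complex. topological_character \<chi> \<and> \<chi> \<noteq> (\<lambda>x. 1) \<longrightarrow> \<chi> g \<noteq> 1"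
    and f: "continuous_on UNIV f" "\<And>x. f (g + x) = f x"
  shows "f x = f y"
proof -
  define f0 where "f0 = (\<lambda>x. f x - mean f)"
  have cf: "continuous_on UNIV f0" unfolding f0_def by (intro continuous_intros f)
  have "mean f0 = 0" unfolding f0_def
    by (simp add: mean_diff[OF f(1)] mean_const continuous_on_const)
  have "f0 = (\<lambda>_. 0)"
  proof (rule ccontr)
    assume nz: "f0 \<noteq> (\<lambda>_. 0)"
    define k where "k = conv f0 (adj f0)"
    note comm = conv_commute and assoc = conv_assoc
    have caf: "continuous_on UNIV (adj f0)" by (rule continuous_on_adj[OF cf])
    have ck: "continuous_on UNIV k" unfolding k_def by (rule continuous_on_conv[OF cf caf])
    have "adj k = k" unfolding k_def adj_conv[OF cf caf] adj_adj by (rule comm[OF caf cf])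
    moreover have "k \<noteq> (\<lambda>_. 0)"
    proof -
      have "k 0 = of_real (sqnorm f0)"
        unfolding k_def comm[OF cf caf] by (rule conv_adj_self_at_0[OF cf])
      then show ?thesis using sqnorm_pos[OF cf nz] by auto
    qed
    ultimately obtain p \<rho> where p: "projection p" and \<rho>: "\<rho> > 0"
      and kkp: "conv (conv k k) p = (\<lambda>x. of_real \<rho> * p x)"
      using top_projection[OF ck] by blast
    obtain \<chi> where \<chi>: "topological_character \<chi>" and p\<chi>: "conv p \<chi> = \<chi>"
      using projection_dominates_character[OF p] by blast
    have cp: "continuous_on UNIV p" and c\<chi>: "continuous_on UNIV \<chi>"
      using p \<chi> by (auto simp: projection_def topological_character_def)
    have ckk: "continuous_on UNIV (conv k k)" by (rule continuous_on_conv[OF ck ck])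
    have eig: "conv k (conv k \<chi>) = (\<lambda>x. of_real \<rho> * \<chi> x)"
    proof -
      have "conv k (conv k \<chi>) = conv (conv k k) (conv p \<chi>)" by (simp only: assoc[OF ck ck c\<chi>] p\<chi>)
      also have "\<dots> = conv (conv (conv k k) p) \<chi>" by (rule assoc[OF ckk cp c\<chi>, symmetric])
      also have "\<dots> = (\<lambda>x. of_real \<rho> * \<chi> x)"
        by (simp only: kkp conv_cmult_left[OF cp c\<chi>] p\<chi>)
      finally show ?thesis .
    qed
    have "(\<lambda>x. f0 (g + x)) = f0" by (simp add: f0_def f)
    then have kg: "(\<lambda>x. k (g + x)) = k"
      unfolding k_def conv_translate_left[symmetric] by simp
    have "of_real \<rho> * \<chi> (g + 0) = of_real \<rho> * \<chi> 0"
    proof -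
      have "conv k (conv k \<chi>) (g + 0) = conv (\<lambda>x. k (g + x)) (conv k \<chi>) 0"
        unfolding conv_translate_left ..
      then show ?thesis by (simp only: kg eig)
    qed
    then have "\<chi> g = \<chi> 0" using \<rho> by simp
    moreover have "\<chi> 0 = \<chi> 0 * \<chi> 0" "norm (\<chi> 0) = 1"
      using \<chi> unfolding topological_character_def by (metis add_0, blast)
    ultimately have "\<chi> g = 1" by auto
    then have "\<chi> = (\<lambda>_. 1)" using chars \<chi> by blast
    moreover have c1: "continuous_on UNIV (\<lambda>_::'a. 1 :: complex)" by (intro continuous_intros)
    have "conv k (\<lambda>_. 1) = (\<lambda>_. 0)"
    proof -
      have "conv k (\<lambda>_. 1) = conv (\<lambda>_. 1) k" by (rule comm[OF ck c1])
      also have "\<dots> = conv (conv (\<lambda>_. 1) f0) (adj f0)"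
        unfolding k_def by (rule assoc[OF c1 cf caf, symmetric])
      also have "\<dots> = (\<lambda>_. 0)"
        by (simp only: conv_one_left[OF cf] \<open>mean f0 = 0\<close> conv_zero_left)
      finally show ?thesis .
    qed
    ultimately have "(\<lambda>_::'a. 0) = (\<lambda>_::'a. complex_of_real \<rho>)"
      using eig by (simp add: conv_zero_right)
    then show False using \<rho> by (simp add: fun_eq_iff)
  qed
  then have "f z = mean f" for z by (auto simp: f0_def fun_eq_iff)
  then show ?thesis by simp
qed

end

section \<open>Birkhoff sums and the cohomological equation\<close>

text \<open>
  In contrast to \<open>orbit_sum\<close>, exactly \<open>n\<close> terms are added. The empty sum is included, and the cocycle
  identity takes its simplest form.
\<close>
definition birkhoff :: "'a::ab_group_add \<Rightarrow> ('a \<Rightarrow> 'b::comm_monoid_add) \<Rightarrow> nat \<Rightarrow> 'a \<Rightarrow> 'b" where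
  "birkhoff g \<gamma> n x = (\<Sum>k<n. \<gamma> (nat_multiple k g + x))"

lemma orbit_sum_eq_birkhoff: "orbit_sum g \<gamma> n x = birkhoff g \<gamma> (Suc n) x"
  by (simp add: orbit_sum_def birkhoff_def atLeast0AtMost lessThan_Suc_atMost)

lemma nat_multiple_add: "nat_multiple (m + n) g = nat_multiple m g + nat_multiple n g"
  by (induction m) (auto simp: add.assoc)

lemma birkhoff_cocycle:
  "birkhoff g \<gamma> (m + n) x = birkhoff g \<gamma> m x + birkhoff g \<gamma> n (nat_multiple m g + x)"
proof (induction n)
  case (Suc n)
  have "nat_multiple (m + n) g + x = nat_multiple n g + (nat_multiple m g + x)"
    by (simp add: nat_multiple_add add_ac)
  with Suc show ?case by (simp add: birkhoff_def add.assoc)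
qed (simp add: birkhoff_def)

lemma continuous_on_birkhoff:
  fixes \<gamma> :: "'a::topological_ab_group_add \<Rightarrow> 'b::real_normed_vector"
  assumes "continuous_on UNIV \<gamma>"
  shows "continuous_on UNIV (birkhoff g \<gamma> n)"
  unfolding birkhoff_def[abs_def]
  by (intro continuous_intros continuous_on_UNIV_compose[OF assms])

lemma birkhoff_bounded:
  assumes "orbit_sums_bounded g \<gamma>"
  obtains M where "\<And>n x. norm (birkhoff g \<gamma> n x) \<le> M"
proof -
  obtain M where M: "\<And>n x. norm (birkhoff g \<gamma> (Suc n) x) \<le> M"
    using assms unfolding orbit_sums_bounded_def orbit_sum_eq_birkhoff by blast
  have "norm (birkhoff g \<gamma> n x) \<le> max M 0" for n x
    using M[of "n - 1" x] by (cases n) (auto simp: birkhoff_def)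
  then show ?thesis using that by blast
qed

lemma birkhoff_solution:
  assumes "\<And>x. \<phi> (g + x) - \<phi> x = \<gamma> x"
  shows "birkhoff g \<gamma> n x = \<phi> (nat_multiple n g + x) - (\<phi> x :: 'b::ab_group_add)"
proof (induction n)
  case (Suc n)
  have "birkhoff g \<gamma> (Suc n) x = birkhoff g \<gamma> n x + \<gamma> (nat_multiple n g + x)"
    by (simp add: birkhoff_def)
  also have "\<dots> = \<phi> (g + (nat_multiple n g + x)) - \<phi> x"
    unfolding Suc assms[symmetric] by simp
  finally show ?case by (simp add: add.assoc)
qed (simp add: birkhoff_def)

lemma up_to_constant_shift:
  fixes f :: "'a \<Rightarrow> 'b::ab_group_add"
  shows "(\<exists>c. \<forall>x. \<phi> x = f x - \<mu> + c) \<longleftrightarrow> (\<exists>c. \<forall>x. \<phi> x = f x + c)"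
proof
  assume "\<exists>c. \<forall>x. \<phi> x = f x - \<mu> + c"
  then obtain c where "\<And>x. \<phi> x = f x - \<mu> + c" by blast
  then have "\<forall>x. \<phi> x = f x + (c - \<mu>)" by (simp add: algebra_simps)
  then show "\<exists>c. \<forall>x. \<phi> x = f x + c" by blast
next
  assume "\<exists>c. \<forall>x. \<phi> x = f x + c"
  then obtain c where "\<And>x. \<phi> x = f x + c" by blast
  then have "\<forall>x. \<phi> x = f x - \<mu> + (c + \<mu>)" by simp
  then show "\<exists>c. \<forall>x. \<phi> x = f x - \<mu> + c" by blast
qed

lemma continuous_on_from_modulus:
  fixes f :: "'a::topological_ab_group_add \<Rightarrow> 'b::real_normed_vector"
  assumes "\<And>e. e > 0 \<Longrightarrow> \<exists>U. open U \<and> 0 \<in> U \<and> (\<forall>u\<in>U. \<forall>x. norm (f (u + x) - f x) \<le> e)"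
  shows "continuous_on UNIV f"
  unfolding continuous_on_def
proof (intro ballI tendstoI)
  fix x0 :: 'a and e :: real assume "e > 0"
  then obtain U where U: "open U" "0 \<in> U" "\<And>u x. u \<in> U \<Longrightarrow> norm (f (u + x) - f x) \<le> e / 2"
    using assms[of "e / 2"] by auto
  have "open {x. x - x0 \<in> U}"
    using open_vimage[OF U(1), of "\<lambda>x. x - x0"] by (simp add: vimage_def continuous_intros)
  moreover have "dist (f x) (f x0) < e" if "x - x0 \<in> U" for x
    using U(3)[OF that, of x0] \<open>e > 0\<close> by (simp add: dist_norm)
  ultimately show "eventually (\<lambda>x. dist (f x) (f x0) < e) (at x0 within UNIV)"
    using U(2) by (auto simp: eventually_at_topological intro!: exI[of _ "{x. x - x0 \<in> U}"])
qed

context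
  fixes g :: "'a::topological_ab_group_add"
  assumes compact_UNIV: "compact (UNIV :: 'a::topological_ab_group_add set)"
    and chars: "\<forall>\<chi> :: 'a \<Rightarrow> complex. topological_character \<chi> \<and> \<chi> \<noteq> (\<lambda>x. 1) \<longrightarrow> \<chi> g \<noteq> 1"
begin

text \<open>
  The scalar invariant function \<open>norm (f x - f y)\<close> vanishes at \<open>y\<close>.
\<close>
lemma invariant_is_constant:
  fixes f :: "'a \<Rightarrow> 'b::real_normed_vector"
  assumes "continuous_on UNIV f" "\<And>x. f (g + x) = f x"
  shows "f x = f y"
proof -
  have "continuous_on UNIV (\<lambda>x. complex_of_real (norm (f x - f y)))" by (intro continuous_intros assms(1))
  from invariant_continuous_is_constant[OF compact_UNIV chars this, of x y]
  show ?thesis by (simp add: assms(2))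
qed

text \<open>
  The nonnegative function \<open>m x - m (g + x)\<close> has mean \<open>0\<close> by translation invariance of the mean, so it vanishes.
\<close>
lemma subinvariant_is_constant:
  fixes m :: "'a \<Rightarrow> real"
  assumes c: "continuous_on UNIV m" and le: "\<And>x. m (g + x) \<le> m x"
  shows "m x = m y"
proof -
  have c1: "continuous_on UNIV (\<lambda>x. complex_of_real (m x))" by (intro continuous_intros c)
  have c2: "continuous_on UNIV (\<lambda>x. m (g + x))" by (intro continuous_intros continuous_on_UNIV_compose[OF c])
  have "mean (\<lambda>x. complex_of_real (m x - m (g + x))) = 0"
    using mean_diff[OF compact_UNIV c1, of "\<lambda>x. complex_of_real (m (g + x))"] c2
      mean_translate[OF compact_UNIV c1, of g] by (simp add: continuous_on_of_real)
  moreover have "continuous_on UNIV (\<lambda>x. m x - m (g + x))" by (intro continuous_intros c c2)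
  ultimately have "\<not> m x - m (g + x) > 0" for x
    using mean_pos[OF compact_UNIV, of "\<lambda>x. m x - m (g + x)" x] le by auto
  then have "m (g + x) = m x" for x using le[of x] by (simp add: not_less order_antisym)
  then show ?thesis using invariant_is_constant[OF c] by blast
qed

text \<open>
  The supremum of \<open>f\<close> over the forward orbit of \<open>x\<close> depends continuously on \<open>x\<close>, since the functions
  \<open>f (n g + x)\<close> share one modulus of continuity, and it can only decrease when \<open>x\<close> moves to \<open>g + x\<close>. So it
  is a constant, which is at least every value \<open>f y\<close>. This takes the place of the density of
  forward orbits.
\<close>
lemma forward_orbit_approaches_values:
  fixes f :: "'a \<Rightarrow> real"
  assumes c: "continuous_on UNIV f" and "e > 0"
  shows "\<exists>n. f (nat_multiple n g + x) > f y - e"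
proof -
  obtain B where B: "\<And>x. norm (f x) \<le> B" using compact_bounded_continuous[OF compact_UNIV c] by blast
  define m where "m x = (SUP n. f (nat_multiple n g + x))" for x
  have f_le: "f x \<le> B" for x using B[of x] by simp
  have bdd: "bdd_above (range (\<lambda>n. f (nat_multiple n g + x)))" for x
    by (rule bdd_aboveI[of _ B]) (use f_le in auto)
  have up: "f (nat_multiple n g + x) \<le> m x" for n x
    unfolding m_def by (rule cSUP_upper[OF _ bdd]) simp
  have "m (g + x) \<le> m x" for x
    unfolding m_def[of "g + x"]
  proof (rule cSUP_least)
    show "f (nat_multiple n g + (g + x)) \<le> m x" for n using up[of "Suc n" x] by (simp add: add_ac)
  qed simp
  moreover have "continuous_on UNIV m"
  proof (rule continuous_on_from_modulus)
    fix e :: real assume "e > 0"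
    have "equicontinuous {f}" by (rule equicontinuous_single[OF compact_UNIV c])
    with \<open>e > 0\<close> have "\<exists>U. open U \<and> 0 \<in> U \<and> (\<forall>u\<in>U. \<forall>x. norm (f (u + x) - f x) \<le> e)"
      by (simp add: equicontinuous_def)
    then obtain U where U: "open U" "0 \<in> U" "\<And>u x. u \<in> U \<Longrightarrow> norm (f (u + x) - f x) \<le> e"
      by blast
    have "norm (m (u + x) - m x) \<le> e" if u: "u \<in> U" for u x
    proof -
      have close: "\<bar>f (nat_multiple n g + (u + x)) - f (nat_multiple n g + x)\<bar> \<le> e" for n
        using U(3)[OF u, of "nat_multiple n g + x"] by (simp add: add.left_commute)
      have "m (u + x) \<le> m x + e"
        unfolding m_def[of "u + x"]
      proof (rule cSUP_least)
        show "f (nat_multiple n g + (u + x)) \<le> m x + e" for n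
          using up[of n x] close[of n] by linarith
      qed simp
      moreover have "m x \<le> m (u + x) + e"
        unfolding m_def[of x]
      proof (rule cSUP_least)
        show "f (nat_multiple n g + x) \<le> m (u + x) + e" for n
          using up[of n "u + x"] close[of n] by linarith
      qed simp
      ultimately show ?thesis by simp
    qed
    with U(1,2) show "\<exists>U. open U \<and> 0 \<in> U \<and> (\<forall>u\<in>U. \<forall>x. norm (m (u + x) - m x) \<le> e)" by blast
  qed
  ultimately have "m x = m y" using subinvariant_is_constant by blast
  moreover have "f y \<le> m y" using up[of 0 y] by simp
  ultimately have "f y - e < (SUP n. f (nat_multiple n g + x))" using \<open>e > 0\<close> by (simp add: m_def)
  then show ?thesis using less_cSUP_iff[OF _ bdd] by blast
qed

text \<open>
  The \<open>n\<close>-th Birkhoff sum has mean \<open>n\<close> times that of \<open>\<gamma>\<close>.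
\<close>
lemma mean_eq_0_if_birkhoff_bounded:
  fixes \<gamma> :: "'a \<Rightarrow> real"
  assumes c: "continuous_on UNIV \<gamma>" and M: "\<And>n x. \<bar>birkhoff g \<gamma> n x\<bar> \<le> M"
  shows "mean (\<lambda>x. complex_of_real (\<gamma> x)) = 0"
proof -
  let ?\<mu> = "mean (\<lambda>x. complex_of_real (\<gamma> x))"
  have c1: "continuous_on UNIV (\<lambda>x. complex_of_real (\<gamma> x))" by (intro continuous_intros c)
  have cb: "continuous_on UNIV (\<lambda>x. complex_of_real (birkhoff g \<gamma> n x))" for n
    by (intro continuous_intros continuous_on_birkhoff c)
  have "mean (\<lambda>x. complex_of_real (birkhoff g \<gamma> n x)) = of_nat n * ?\<mu>" for n
  proof (induction n)
    case (Suc n)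
    have "continuous_on UNIV (\<lambda>x. complex_of_real (\<gamma> (nat_multiple n g + x)))"
      by (intro continuous_intros continuous_on_UNIV_compose[OF c])
    from mean_add[OF compact_UNIV cb this, of n] Suc mean_translate[OF compact_UNIV c1, of "nat_multiple n g"]
    show ?case by (simp add: birkhoff_def algebra_simps)
  qed (simp add: birkhoff_def mean_const[OF compact_UNIV])
  then have "real n * norm ?\<mu> \<le> M" for n
    using norm_mean_le_const[OF compact_UNIV cb, of n M] M by (simp add: norm_mult)
  then show ?thesis
    using reals_Archimedean3[of "norm ?\<mu>"] by (metis not_less zero_less_norm_iff)
qed

text \<open>
  Let \<open>\<Phi>\<close> be the supremum of all Birkhoff sums, and \<open>S\<close> its supremum over the group. If the \<open>n\<close>-th sum starting
  at a point is within \<open>2 \<epsilon>\<close> of \<open>S\<close>, then no later continuation can gain more than \<open>2 \<epsilon>\<close>. Every orbit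
  passes through such points after finitely many steps, and does so at the same time for all nearby
  starting points. Near any \<open>x\<close>, therefore, \<open>\<Phi>\<close> agrees up to a multiple of \<open>\<epsilon>\<close> with the maximum of finitely
  many continuous functions, and so it is continuous. The defect \<open>D\<close> of the equation for \<open>\<Phi>\<close> is nonnegative
  with mean \<open>0\<close>.
\<close>
lemma bounded_birkhoff_sums_solution:
  fixes \<gamma> :: "'a \<Rightarrow> real"
  assumes c: "continuous_on UNIV \<gamma>" and b: "orbit_sums_bounded g \<gamma>"
  shows "\<exists>\<phi>. continuous_solution g \<gamma> \<phi>"
proof -
  let ?B = "birkhoff g \<gamma>"
  let ?T = "\<lambda>n x. nat_multiple n g + x"
  obtain M where M: "\<And>n x. \<bar>?B n x\<bar> \<le> M" using birkhoff_bounded[OF b] by auto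
  have cB: "continuous_on UNIV (?B n)" for n by (rule continuous_on_birkhoff[OF c])
  define \<Phi> where "\<Phi> x = (SUP n. ?B n x)" for x
  have B_le_M: "?B n x \<le> M" for n x using M[of n x] by linarith
  have bdd: "bdd_above (range (\<lambda>n. ?B n x))" for x
    by (rule bdd_aboveI[of _ M]) (use B_le_M in auto)
  have up: "?B n x \<le> \<Phi> x" for n x unfolding \<Phi>_def by (rule cSUP_upper[OF _ bdd]) simp
  have least: "\<Phi> x \<le> t" if "\<And>n. ?B n x \<le> t" for x t
    unfolding \<Phi>_def by (rule cSUP_least) (use that in auto)
  have bddS: "bdd_above (range (\<lambda>(n, x). ?B n x))"
    by (rule bdd_aboveI[of _ M]) (use B_le_M in auto)
  define S where "S = (SUP (n, x). ?B n x)"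
  have le_S: "?B n x \<le> S" for n x
    using cSUP_upper[OF _ bddS, of "(n, x)"] by (simp add: S_def)
  have cont: "continuous_on UNIV \<Phi>"
    unfolding continuous_on_def
  proof (intro ballI tendstoI)
    fix x :: 'a and e :: real assume "e > 0"
    define \<epsilon> where "\<epsilon> = e / 4"
    have "\<epsilon> > 0" using \<open>e > 0\<close> by (simp add: \<epsilon>_def)
    then have "S - \<epsilon> < (SUP (n, x). ?B n x)" by (simp add: S_def)
    then obtain n y where ny: "S - \<epsilon> < ?B n y"
      using less_cSUP_iff[OF _ bddS] by (auto simp: split_def)
    obtain j where "?B n y - \<epsilon> < ?B n (?T j x)"
      using forward_orbit_approaches_values[OF cB \<open>\<epsilon> > 0\<close>, of n y x] by blast
    with ny have j: "S - 2 * \<epsilon> < ?B n (?T j x)" by linarith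
    define W where "W = {x'. S - 2 * \<epsilon> < ?B n (?T j x')}"
    define N where "N = j + n"
    have "open W" unfolding W_def
      by (intro open_Collect_less continuous_intros continuous_on_UNIV_compose[OF cB])
    have "x \<in> W" using j by (simp add: W_def)
    have small: "?B i (?T N z) \<le> 2 * \<epsilon>" if "z \<in> W" for z i
    proof -
      have "?T n (?T j z) = ?T N z" by (simp add: N_def nat_multiple_add add_ac)
      with birkhoff_cocycle[of g \<gamma> n i "?T j z"]
      have "?B (n + i) (?T j z) = ?B n (?T j z) + ?B i (?T N z)" by simp
      then show ?thesis using le_S[of "n + i" "?T j z"] that by (simp add: W_def)
    qed
    \<comment> \<open>Sums of at most \<open>N\<close> terms are compared term by term; a longer sum gains at most \<open>2 * \<epsilon>\<close> after
    step \<open>N\<close>.\<close>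
    have near: "\<Phi> z \<le> \<Phi> z' + 3 * \<epsilon>"
      if "z \<in> W" and d: "\<And>i. i \<le> N \<Longrightarrow> \<bar>?B i z - ?B i z'\<bar> \<le> \<epsilon>" for z z'
    proof (rule least)
      fix i
      show "?B i z \<le> \<Phi> z' + 3 * \<epsilon>"
      proof (cases "i \<le> N")
        case True
        then show ?thesis using d[of i] up[of i z'] \<open>\<epsilon> > 0\<close> by linarith
      next
        case False
        then have "?B i z = ?B N z + ?B (i - N) (?T N z)"
          using birkhoff_cocycle[of g \<gamma> N "i - N" z] by simp
        then show ?thesis using small[OF \<open>z \<in> W\<close>, of "i - N"] d[of N] up[of N z'] by linarith
      qed
    qed
    have "eventually (\<lambda>x'. \<forall>i\<in>{..N}. dist (?B i x') (?B i x) < \<epsilon>) (at x within UNIV)"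
      using cB \<open>\<epsilon> > 0\<close>
      by (intro eventually_ball_finite ballI tendstoD) (auto simp: continuous_on_def)
    moreover have "eventually (\<lambda>x'. x' \<in> W) (at x within UNIV)"
      using \<open>open W\<close> \<open>x \<in> W\<close> by (auto simp: eventually_at_topological)
    ultimately show "eventually (\<lambda>x'. dist (\<Phi> x') (\<Phi> x) < e) (at x within UNIV)"
    proof eventually_elim
      case (elim x')
      then have "\<bar>?B i x' - ?B i x\<bar> \<le> \<epsilon>" "\<bar>?B i x - ?B i x'\<bar> \<le> \<epsilon>" if "i \<le> N" for i
        using that by (auto simp: dist_real_def abs_minus_commute less_imp_le)
      then have "\<Phi> x \<le> \<Phi> x' + 3 * \<epsilon>" "\<Phi> x' \<le> \<Phi> x + 3 * \<epsilon>"
        using near[OF \<open>x \<in> W\<close>] near[OF elim(2)] by auto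
      then show ?case using \<open>e > 0\<close> by (simp add: dist_real_def \<epsilon>_def)
    qed
  qed
  define D where "D x = \<Phi> x - \<gamma> x - \<Phi> (g + x)" for x
  have D_nonneg: "D x \<ge> 0" for x
  proof -
    have "\<Phi> (g + x) \<le> \<Phi> x - \<gamma> x"
    proof (rule least)
      show "?B n (g + x) \<le> \<Phi> x - \<gamma> x" for n
        using birkhoff_cocycle[of g \<gamma> 1 n x] up[of "1 + n" x] by (simp add: birkhoff_def)
    qed
    then show ?thesis by (simp add: D_def)
  qed
  have ct: "continuous_on UNIV (\<lambda>x. \<Phi> (g + x))"
    by (intro continuous_intros continuous_on_UNIV_compose[OF cont])
  have cD: "continuous_on UNIV D" unfolding D_def[abs_def] by (intro continuous_intros cont c ct)
  have mean_D: "mean (\<lambda>x. complex_of_real (D x)) = 0"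
  proof -
    have cs: "continuous_on UNIV (\<lambda>x. complex_of_real (\<Phi> x))" "continuous_on UNIV (\<lambda>x. complex_of_real (\<gamma> x))"
      "continuous_on UNIV (\<lambda>x. complex_of_real (\<Phi> (g + x)))" by (intro continuous_intros cont c ct)+
    show ?thesis
      unfolding D_def of_real_diff mean_diff[OF compact_UNIV continuous_on_diff[OF cs(1,2)] cs(3)]
        mean_diff[OF compact_UNIV cs(1,2)] mean_eq_0_if_birkhoff_bounded[OF c M]
        mean_translate[OF compact_UNIV cs(1)] by simp
  qed
  have D0: "D x = 0" for x
    using mean_pos[OF compact_UNIV cD D_nonneg, of x] D_nonneg[of x] by (fastforce simp: mean_D)
  have "- \<Phi> (g + x) - - \<Phi> x = \<gamma> x" for x using D0[of x] by (simp add: D_def)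
  then have "continuous_solution g \<gamma> (\<lambda>x. - \<Phi> x)"
    unfolding continuous_solution_def by (simp add: continuous_on_minus cont)
  then show ?thesis by blast
qed

text \<open>
  The sums telescope to \<open>\<psi> x - \<psi> (n g + (g + x))\<close>. Along the forward orbit of \<open>g + x\<close>
  the function \<open>\<psi>\<close> comes arbitrarily close to its minimum \<open>\<mu>\<close>.
\<close>
lemma solution_sup_formula:
  fixes \<gamma> :: "'a \<Rightarrow> real"
  assumes "continuous_solution g \<gamma> \<psi>"
  obtains \<mu> where "\<And>x. (SUP n. - orbit_sum g \<gamma> n x) = \<psi> x - \<mu>"
proof -
  have c: "continuous_on UNIV \<psi>" and eq: "\<And>x. \<psi> (g + x) - \<psi> x = \<gamma> x"
    using assms by (auto simp: continuous_solution_def)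
  obtain y where y: "\<And>x. \<psi> y \<le> \<psi> x"
    using continuous_attains_inf[OF compact_UNIV _ c] by auto
  have os: "- orbit_sum g \<gamma> n x = \<psi> x - \<psi> (nat_multiple n g + (g + x))" for n x
    using birkhoff_solution[where \<phi> = \<psi> and g = g and \<gamma> = \<gamma>, OF eq, of "Suc n" x]
    by (simp add: orbit_sum_eq_birkhoff add_ac)
  have "(SUP n. - orbit_sum g \<gamma> n x) = \<psi> x - \<psi> y" for x
  proof (rule cSup_eq_non_empty)
    show "t \<le> \<psi> x - \<psi> y" if "t \<in> range (\<lambda>n. - orbit_sum g \<gamma> n x)" for t
      using that y by (auto simp: os)
    show "\<psi> x - \<psi> y \<le> t" if t: "\<And>s. s \<in> range (\<lambda>n. - orbit_sum g \<gamma> n x) \<Longrightarrow> s \<le> t" for t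
    proof (rule field_le_epsilon)
      fix e :: real assume "e > 0"
      have "continuous_on UNIV (\<lambda>x. - \<psi> x)" by (intro continuous_intros c)
      from forward_orbit_approaches_values[OF this \<open>e > 0\<close>, of y "g + x"]
      obtain n where n: "- \<psi> y - e < - \<psi> (nat_multiple n g + (g + x))" by blast
      have "- orbit_sum g \<gamma> n x \<le> t" by (rule t) blast
      then show "\<psi> x - \<psi> y \<le> t + e" using n unfolding os by linarith
    qed
  qed simp
  then show ?thesis using that by blast
qed

lemma solutions_up_to_constant:
  fixes \<gamma> :: "'a \<Rightarrow> 'b::real_normed_vector"
  assumes \<psi>: "continuous_solution g \<gamma> \<psi>"
  shows "continuous_solution g \<gamma> \<phi> \<longleftrightarrow> (\<exists>c. \<forall>x. \<phi> x = \<psi> x + c)"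
proof
  assume \<phi>: "continuous_solution g \<gamma> \<phi>"
  have "continuous_on UNIV (\<lambda>x. \<phi> x - \<psi> x)"
    using \<phi> \<psi> by (simp add: continuous_solution_def continuous_on_diff)
  moreover have "\<phi> (g + x) - \<psi> (g + x) = \<phi> x - \<psi> x" for x
  proof -
    have "\<phi> (g + x) - \<phi> x = \<psi> (g + x) - \<psi> x" using \<phi> \<psi> by (simp add: continuous_solution_def)
    then show ?thesis by (simp add: algebra_simps)
  qed
  ultimately have "\<phi> x - \<psi> x = \<phi> 0 - \<psi> 0" for x by (rule invariant_is_constant)
  then have "\<phi> x = \<psi> x + (\<phi> 0 - \<psi> 0)" for x by (metis add.commute diff_add_cancel)
  then show "\<exists>c. \<forall>x. \<phi> x = \<psi> x + c" by blast
next
  assume "\<exists>c. \<forall>x. \<phi> x = \<psi> x + c"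
  then obtain c where "\<phi> = (\<lambda>x. \<psi> x + c)" by auto
  then show "continuous_solution g \<gamma> \<phi>"
    using \<psi> by (simp add: continuous_solution_def continuous_on_add continuous_on_const)
qed

lemma solution_imp_bounded:
  fixes \<gamma> :: "'a \<Rightarrow> 'b::real_normed_vector"
  assumes "continuous_solution g \<gamma> \<phi>"
  shows "continuous_on UNIV \<gamma> \<and> orbit_sums_bounded g \<gamma>"
proof
  have c: "continuous_on UNIV \<phi>" and eq: "\<And>x. \<phi> (g + x) - \<phi> x = \<gamma> x"
    using assms by (auto simp: continuous_solution_def)
  have "continuous_on UNIV (\<lambda>x. \<phi> (g + x) - \<phi> x)"
    by (intro continuous_intros continuous_on_UNIV_compose[OF c])
  then show "continuous_on UNIV \<gamma>" by (simp add: eq)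
  obtain B where B: "\<And>x. norm (\<phi> x) \<le> B" using compact_bounded_continuous[OF compact_UNIV c] by blast
  have "norm (orbit_sum g \<gamma> n x) \<le> B + B" for n x
    unfolding orbit_sum_eq_birkhoff birkhoff_solution[where \<phi> = \<phi> and g = g and \<gamma> = \<gamma>, OF eq]
    by (intro norm_triangle_le_diff add_mono B)
  then show "orbit_sums_bounded g \<gamma>" unfolding orbit_sums_bounded_def by blast
qed

lemma complex_bounded_orbit_sums_solution:
  fixes \<delta> :: "'a \<Rightarrow> complex"
  assumes c: "continuous_on UNIV \<delta>" and b: "orbit_sums_bounded g \<delta>"
  shows "\<exists>\<phi>. continuous_solution g \<delta> \<phi>"
proof -
  obtain M where M: "\<And>n x. norm (orbit_sum g \<delta> n x) \<le> M" using b unfolding orbit_sums_bounded_def by blast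
  have "orbit_sums_bounded g (\<lambda>x. Re (\<delta> x))" "orbit_sums_bounded g (\<lambda>x. Im (\<delta> x))"
    unfolding orbit_sums_bounded_def
    using order_trans[OF abs_Re_le_cmod M] order_trans[OF abs_Im_le_cmod M]
    by (auto simp: orbit_sum_def)
  moreover have "continuous_on UNIV (\<lambda>x. Re (\<delta> x))" "continuous_on UNIV (\<lambda>x. Im (\<delta> x))"
    by (intro continuous_intros c)+
  ultimately obtain \<phi>1 \<phi>2 where "continuous_solution g (\<lambda>x. Re (\<delta> x)) \<phi>1" "continuous_solution g (\<lambda>x. Im (\<delta> x)) \<phi>2"
    using bounded_birkhoff_sums_solution by blast
  then have "continuous_solution g \<delta> (\<lambda>x. Complex (\<phi>1 x) (\<phi>2 x))"
    by (auto simp: continuous_solution_def complex_eq_iff intro: continuous_on_Complex)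
  then show ?thesis by blast
qed

end

theorem theorem7p6:
  fixes g :: "'a::topological_ab_group_add"
    and \<gamma> :: "'a \<Rightarrow> real"
    and \<delta> :: "'a \<Rightarrow> complex"
  assumes "compact (UNIV :: 'a set)"
    and "\<forall>\<chi> :: 'a \<Rightarrow> complex. topological_character \<chi> \<and> \<chi> \<noteq> (\<lambda>x. 1) \<longrightarrow> \<chi> g \<noteq> 1"
  shows "((\<exists>\<phi>. continuous_solution g \<gamma> \<phi>) \<longleftrightarrow>
            continuous_on UNIV \<gamma> \<and> orbit_sums_bounded g \<gamma>) \<and>
         ((\<exists>\<phi>. continuous_solution g \<delta> \<phi>) \<longleftrightarrow>
            continuous_on UNIV \<delta> \<and> orbit_sums_bounded g \<delta>) \<and>
         (continuous_on UNIV \<gamma> \<and> orbit_sums_bounded g \<gamma> \<longrightarrow>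
            (\<forall>\<phi>. continuous_solution g \<gamma> \<phi> \<longleftrightarrow>
              (\<exists>c::real. \<forall>x. \<phi> x = (SUP n. - orbit_sum g \<gamma> n x) + c))) \<and>
         (continuous_on UNIV \<delta> \<and> orbit_sums_bounded g \<delta> \<and> (\<forall>x. \<delta> x \<in> \<real>) \<longrightarrow>
            (\<forall>\<phi>. continuous_solution g \<delta> \<phi> \<longleftrightarrow>
              (\<exists>c::complex. \<forall>x. \<phi> x =
                 complex_of_real (SUP n. - Re (orbit_sum g \<delta> n x)) + c)))"
proof (intro conjI impI allI)
  show "(\<exists>\<phi>. continuous_solution g \<gamma> \<phi>) \<longleftrightarrow> continuous_on UNIV \<gamma> \<and> orbit_sums_bounded g \<gamma>"
    using solution_imp_bounded[OF assms] bounded_birkhoff_sums_solution[OF assms] by blast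
  show "(\<exists>\<phi>. continuous_solution g \<delta> \<phi>) \<longleftrightarrow> continuous_on UNIV \<delta> \<and> orbit_sums_bounded g \<delta>"
    using solution_imp_bounded[OF assms] complex_bounded_orbit_sums_solution[OF assms] by blast
next
  fix \<phi> :: "'a \<Rightarrow> real"
  assume "continuous_on UNIV \<gamma> \<and> orbit_sums_bounded g \<gamma>"
  then obtain \<psi> where \<psi>: "continuous_solution g \<gamma> \<psi>"
    using bounded_birkhoff_sums_solution[OF assms] by blast
  then obtain \<mu> where \<mu>: "\<And>x. (SUP n. - orbit_sum g \<gamma> n x) = \<psi> x - \<mu>"
    using solution_sup_formula[OF assms] by blast
  show "continuous_solution g \<gamma> \<phi> \<longleftrightarrow>
      (\<exists>c::real. \<forall>x. \<phi> x = (SUP n. - orbit_sum g \<gamma> n x) + c)"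
    unfolding \<mu> solutions_up_to_constant[OF assms \<psi>] by (rule up_to_constant_shift[symmetric])
next
  fix \<phi> :: "'a \<Rightarrow> complex"
  assume \<delta>: "continuous_on UNIV \<delta> \<and> orbit_sums_bounded g \<delta> \<and> (\<forall>x. \<delta> x \<in> \<real>)"
  let ?\<gamma> = "\<lambda>x. Re (\<delta> x)"
  obtain \<psi>0 where "continuous_solution g \<delta> \<psi>0"
    using complex_bounded_orbit_sums_solution[OF assms] \<delta> by blast
  then have \<psi>: "continuous_solution g ?\<gamma> (\<lambda>x. Re (\<psi>0 x))"
    unfolding continuous_solution_def by (simp add: continuous_on_Re flip: minus_complex.sel)
  define \<psi> where "\<psi> = (\<lambda>x. Re (\<psi>0 x))"
  note \<psi> = \<psi>[folded \<psi>_def]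
  have "\<delta> x = of_real (?\<gamma> x)" for x using \<delta> by (simp add: of_real_Re)
  then have "of_real (\<psi> (g + x)) - of_real (\<psi> x) = \<delta> x" for x
    using \<psi> unfolding continuous_solution_def by (metis of_real_diff)
  then have \<psi>c: "continuous_solution g \<delta> (\<lambda>x. of_real (\<psi> x))"
    using \<psi> unfolding continuous_solution_def by (simp add: continuous_on_of_real)
  obtain \<mu> where \<mu>: "\<And>x. (SUP n. - orbit_sum g ?\<gamma> n x) = \<psi> x - \<mu>"
    using solution_sup_formula[OF assms \<psi>] by blast
  have "orbit_sum g ?\<gamma> n x = Re (orbit_sum g \<delta> n x)" for n x by (simp add: orbit_sum_def)
  then have \<mu>': "(SUP n. - Re (orbit_sum g \<delta> n x)) = \<psi> x - \<mu>" for x using \<mu> by simp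
  show "continuous_solution g \<delta> \<phi> \<longleftrightarrow>
      (\<exists>c::complex. \<forall>x. \<phi> x = complex_of_real (SUP n. - Re (orbit_sum g \<delta> n x)) + c)"
    unfolding \<mu>' of_real_diff solutions_up_to_constant[OF assms \<psi>c]
    by (rule up_to_constant_shift[symmetric])
qed

end
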